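(* Let $S=(r;m_2,m_3,\ldots,m_l)$ be a tree eccentric sequence. Then, among all trees $T$ whose eccentric sequence is $S$, the tree $\mathbf{T}(r;m_2,\ldots,m_l)$ uniquely (up to isomorphism) maximises the generalised Wiener index $W^{\lambda}(T)$ for every real $\lambda<0$, and specifically the Harary index $H(T)$.
   Context: Graphs are finite and simple; $d(u,v)$ is the usual graph distance. The eccentricity of a vertex $v$ is $\max_u d(v,u)$. The eccentric sequence of a connected graph is the nondecreasing sequence of the eccentricities of its vertices. A tree eccentric sequence is a sequence that is the eccentric sequence of some tree; only trees with $n>2$ vertices are considered. For a tree, let $b_1<b_2<\cdots<b_l$ be the distinct eccentricities of its vertices and let $m_j$ be the number of vertices of eccentricity $b_j$. The $b_j$ are consecutive integers, $m_1\in\{1,2\}$, and the eccentric sequence is completely determined by $b_1,m_2,\ldots,m_l$; it is written $S=(b_1;m_2,m_3,\ldots,m_l)$. A tree with eccentric sequence $(r;m_2,\ldots,m_l)$ has radius $r$, diameter $r+l-1$, and exactly $m_j$ vertices of eccentricity $r+j-1$ for $2\le j\le l$. For integers $b_1>0$ and $m_2,\ldots,m_l>1$, $\mathbf{T}(b_1;m_2,\ldots,m_l)$ is the tree obtained from the path $v_0,v_1,\ldots,v_{b_1+l-1}$ by attaching $m_j-2$ pendent edges to the vertex $v_{l+1-j}$ for all $2\le j\le l$. With sums over all unordered pairs $\{u,v\}$ of distinct vertices of a connected graph $G$: $W^{\lambda}(G)=\sum d(u,v)^{\lambda}$ and $H(G)=\sum\frac{1}{d(u,v)}$. *)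

theory Defs
  imports Complex_Main "Graph_Theory.Graph_Theory" "HOL-Library.Multiset"
begin

text \<open>
  Finite simple graphs are the symmetric, loop-free finite pair digraphs of \<open>pair_graph\<close>.
  The constant \<open>tree\<close> of the graph library is not usable here: it is meant for digraphs, and in a
  symmetric digraph it counts every edge, traversed back and forth, as a cycle of length 2.
  In a simple graph the cycles are exactly the library cycles of length at least 3.
\<close>

definition is_tree :: "'a pair_pre_digraph \<Rightarrow> bool" where
  "is_tree G \<longleftrightarrow> pair_graph G \<and> Digraph_Component.connected (with_proj G) \<and>
     \<not> (\<exists>p. pre_digraph.cycle (with_proj G) p \<and> 3 \<le> length p)"

text \<open>Only meaningful for \<open>u\<close>, \<open>v\<close> joined by a walk, in particular in connected graphs.\<close>

definition gdist :: "'a pair_pre_digraph \<Rightarrow> 'a \<Rightarrow> 'a \<Rightarrow> nat" where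
  "gdist G u v = (LEAST n. \<exists>p. pre_digraph.awalk (with_proj G) u p v \<and> length p = n)"

definition eccentricity :: "'a pair_pre_digraph \<Rightarrow> 'a \<Rightarrow> nat" where
  "eccentricity G v = Max (gdist G v ` pverts G)"

definition eccentric_sequence :: "'a pair_pre_digraph \<Rightarrow> nat list" where
  "eccentric_sequence G = sorted_list_of_multiset (image_mset (eccentricity G) (mset_set (pverts G)))"

text \<open>Every finite graph is isomorphic to one whose vertices are natural numbers.\<close>

definition tree_eccentric_sequence :: "nat list \<Rightarrow> bool" where
  "tree_eccentric_sequence S \<longleftrightarrow>
     (\<exists>G :: nat pair_pre_digraph. is_tree G \<and> 2 < card (pverts G) \<and> eccentric_sequence G = S)"

text \<open>
  The short form \<open>(b\<^sub>1; m\<^sub>2, \<dots>, m\<^sub>l)\<close> of a sequence: its least value, followed by the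
  multiplicities of its other distinct values in increasing order.
  Hence \<open>m\<^sub>j\<close> is entry \<open>j - 2\<close> of the list, which has length \<open>l - 1\<close>.
\<close>

definition short_form :: "nat list \<Rightarrow> nat \<times> nat list" where
  "short_form S = (let bs = sorted_list_of_set (set S) in (hd bs, map (count_list S) (tl bs)))"

text \<open>
  The tree \<open>T(b\<^sub>1; m\<^sub>2, \<dots>, m\<^sub>l)\<close>: the path vertex \<open>v\<^sub>i\<close> is \<open>(i, 0)\<close>, and the pendent vertices
  attached to \<open>v\<^sub>i\<close> are \<open>(i, 1), (i, 2), \<dots>\<close>
\<close>

definition ecc_caterpillar :: "nat \<Rightarrow> nat list \<Rightarrow> (nat \<times> nat) pair_pre_digraph" where
  "ecc_caterpillar b ms =
    (let l = length ms + 1;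
         V = {(i, 0) | i. i \<le> b + l - 1} \<union>
             {(l + 1 - j, k) | j k. 2 \<le> j \<and> j \<le> l \<and> 1 \<le> k \<and> k \<le> ms ! (j - 2) - 2};
         E = {((i, 0), (i + 1, 0)) | i. i < b + l - 1} \<union>
             {((l + 1 - j, 0), (l + 1 - j, k)) | j k. 2 \<le> j \<and> j \<le> l \<and> 1 \<le> k \<and> k \<le> ms ! (j - 2) - 2}
     in \<lparr> pverts = V, parcs = E \<union> E\<inverse> \<rparr>)"

definition vertex_pairs :: "'a pair_pre_digraph \<Rightarrow> 'a set set" where
  "vertex_pairs G = {{u, v} | u v. u \<in> pverts G \<and> v \<in> pverts G \<and> u \<noteq> v}"

text \<open>Well defined on graphs because the distance is symmetric.\<close>

definition pair_dist :: "'a pair_pre_digraph \<Rightarrow> 'a set \<Rightarrow> nat" where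
  "pair_dist G e = (THE d. \<exists>u v. e = {u, v} \<and> u \<noteq> v \<and> d = gdist G u v)"

definition wiener :: "real \<Rightarrow> 'a pair_pre_digraph \<Rightarrow> real" where
  "wiener a G = (\<Sum>e\<in>vertex_pairs G. real (pair_dist G e) powr a)"

definition harary :: "'a pair_pre_digraph \<Rightarrow> real" where
  "harary G = (\<Sum>e\<in>vertex_pairs G. 1 / real (pair_dist G e))"

definition graph_iso :: "'a pair_pre_digraph \<Rightarrow> 'b pair_pre_digraph \<Rightarrow> bool" where
  "graph_iso G H \<longleftrightarrow> digraph_iso (with_proj G) (with_proj H)"

end

theory Submission
  imports Defs
begin

text \<open>
Let \<open>T\<close> be a tree of diameter \<open>2 * h + \<delta>\<close> with \<open>\<delta> \<in> {0, 1}\<close>. A central arc of a longest path divides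
the vertices into two sides, and each side reaches up to distance \<open>h\<close> from the centre. The eccentricity
of a vertex is \<open>h + \<delta>\<close> plus its level, the distance to the centre (\<open>eccentricity_lev\<close>). Hence the
eccentric sequence is the same information as \<open>h\<close>, \<open>\<delta>\<close> and the number \<open>n\<^sub>i\<close> of vertices on each level
\<open>i\<close>, and trees with equal sequences can be compared separately for each pair of levels \<open>i \<le> j\<close>.

Apart from the case of a single centre vertex, which has distance \<open>j\<close> from all of level \<open>j\<close>, the pairs
between the two levels are of three kinds. Every vertex of level \<open>j\<close> has exactly one ancestor on level
\<open>i\<close>, at distance \<open>j - i\<close>. Two vertices on different sides have distance \<open>i + j + \<delta>\<close>, and since both sides
meet both levels there are at least \<open>n\<^sub>i + n\<^sub>j - 2\<close> such pairs. For the remaining pairs the minimal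
distance \<open>j - i\<close> is not attained, so parity makes the distance at least \<open>j - i + 2\<close>. For a decreasing
weight \<open>f\<close> this bounds the sum of \<open>f\<close> over the distances in terms of \<open>h\<close>, \<open>\<delta>\<close> and the \<open>n\<^sub>i\<close>
(\<open>level_pair_sum_le\<close>).

If the bound is attained and \<open>f\<close> is strictly decreasing, then one of the sides has a single vertex on
each level and the vertices of a level on the other side are siblings, except where closeness to the
centre settles the shape anyway (\<open>extremal_double_spine\<close>). Such a tree, called a double spine below, is
determined up to isomorphism by the sizes of its levels (\<open>double_spine_iso\<close>). Conversely a double spine
attains the bound (\<open>level_bound_le_dist_sum\<close>), and the caterpillar is a double spine
(\<open>caterpillar_double_spine\<close>). The generalised Wiener indices with negative exponent and the Harary index
are the instances \<open>k powr a\<close> and \<open>1 / k\<close> of the weight.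
\<close>

section \<open>Distances in connected graphs and trees\<close>

locale connected_graph = pair_graph G for G :: "'a pair_pre_digraph" +
  assumes connected: "Digraph_Component.connected (with_proj G)"
begin

abbreviation d where "d \<equiv> gdist G"

lemma verts_nonempty: "pverts G \<noteq> {}"
  using connected by (auto simp: connected_conv)

lemma shortest_walk:
  assumes "u \<in> pverts G" "v \<in> pverts G"
  obtains p where "awalk u p v" "length p = d u v"
proof -
  have "strongly_connected (with_proj G)"
    using symmetric_connected_imp_strongly_connected[OF pair_sym_arcs connected] .
  then have "u \<rightarrow>\<^sup>*\<^bsub>with_proj G\<^esub> v"
    using assms by (auto simp: strongly_connected_def)
  then obtain p where "awalk u p v" by (auto simp: reachable_awalk)
  then have "\<exists>n p. awalk u p v \<and> length p = n" by blast
  then have "\<exists>p. awalk u p v \<and> length p = d u v"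
    unfolding gdist_def by (rule LeastI_ex)
  then show ?thesis using that by blast
qed

lemma dist_le_walk: "awalk u p v \<Longrightarrow> d u v \<le> length p"
  unfolding gdist_def by (intro Least_le) blast

lemma dist_self [simp]: "u \<in> pverts G \<Longrightarrow> d u u = 0"
  using dist_le_walk[of u "[]" u] by (simp add: awalk_Nil_iff)

lemma dist_eq_0_iff:
  assumes "u \<in> pverts G" "v \<in> pverts G"
  shows "d u v = 0 \<longleftrightarrow> u = v"
proof
  assume "d u v = 0"
  then show "u = v"
    using shortest_walk[OF assms] by (metis awalk_Nil_iff length_0_conv)
qed (use assms in simp)

lemma dist_sym:
  assumes "u \<in> pverts G" "v \<in> pverts G"
  shows "d u v = d v u"
proof -
  have len: "length (rev_path p) = length p" for p :: "('a \<times> 'a) list"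
    by (induction p) auto
  have "d v u \<le> d u v" if uv: "u \<in> pverts G" "v \<in> pverts G" for u v
    using shortest_walk[OF uv] dist_le_walk awalk_rev_path len by metis
  then show ?thesis using assms by (simp add: le_antisym)
qed

lemma dist_triangle:
  assumes "u \<in> pverts G" "v \<in> pverts G" "w \<in> pverts G"
  shows "d u w \<le> d u v + d v w"
proof -
  obtain p where p: "awalk u p v" "length p = d u v" using shortest_walk assms by blast
  obtain q where q: "awalk v q w" "length q = d v w" using shortest_walk assms by blast
  have "awalk u (p @ q) w" using p q by (auto intro: awalk_appendI)
  then show ?thesis using dist_le_walk[of u "p @ q" w] p q by simp
qed

lemma dist_eq_1_iff:
  assumes "u \<in> pverts G" "v \<in> pverts G"
  shows "d u v = 1 \<longleftrightarrow> (u, v) \<in> parcs G"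
proof
  assume "d u v = 1"
  then obtain p where p: "awalk u p v" "length p = Suc 0" using shortest_walk[OF assms] by (metis One_nat_def)
  then obtain e where "p = [e]" by (metis length_Suc_conv length_0_conv)
  then show "(u, v) \<in> parcs G" using p by (cases e) (auto simp: awalk_simps)
next
  assume uv: "(u, v) \<in> parcs G"
  then have "d u v \<le> 1"
    using dist_le_walk[of u "[(u, v)]" v] assms by (auto simp: awalk_simps)
  moreover have "d u v \<noteq> 0" using uv dist_eq_0_iff[OF assms] no_loops' by blast
  ultimately show "d u v = 1" by linarith
qed

lemma last_step:
  assumes "u \<in> pverts G" "v \<in> pverts G" "u \<noteq> v"
  obtains w where "w \<in> pverts G" "(w, v) \<in> parcs G" "d u w + 1 = d u v"
proof -
  obtain p where p: "awalk u p v" "length p = d u v" using shortest_walk assms by blast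
  with assms have "p \<noteq> []" by (auto simp: awalk_Nil_iff)
  then obtain q e where pq: "p = q @ [e]" by (metis rev_exhaust)
  then have q: "awalk u q (fst e)" "snd e = v" "e \<in> parcs G"
    using p by (auto simp: awalk_simps)
  have w: "fst e \<in> pverts G" using q(3) wellformed(1) by blast
  have e: "(fst e, v) \<in> parcs G" using q by (metis prod.collapse)
  have "d u (fst e) + 1 \<le> d u v" using dist_le_walk[OF q(1)] p pq by simp
  moreover have "d u v \<le> d u (fst e) + 1"
    using dist_triangle[of u "fst e" v] dist_eq_1_iff[of "fst e" v] w e assms by simp
  ultimately show ?thesis using that w e by simp
qed

lemma arc_dist_le:
  assumes "z \<in> pverts G" "(u, v) \<in> parcs G"
  shows "d z v \<le> d z u + 1" "d z u \<le> d z v + 1"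
proof -
  have V: "u \<in> pverts G" "v \<in> pverts G" using assms in_arcsD1 in_arcsD2 by auto
  have "d u v = 1" "d v u = 1" using V assms dist_eq_1_iff dist_sym by auto
  then show "d z v \<le> d z u + 1" "d z u \<le> d z v + 1"
    using dist_triangle[of z u v] dist_triangle[of z v u] V assms by auto
qed

end

lemma is_tree_connected_graph: "is_tree G \<Longrightarrow> connected_graph G"
  by (simp add: is_tree_def connected_graph_def connected_graph_axioms_def)

locale tree_graph = connected_graph +
  assumes acyclic: "cycle p \<Longrightarrow> length p < 3"
begin

text \<open>
All vertices before the end of a shortest walk from \<open>z\<close> to \<open>w\<close> are strictly nearer to \<open>z\<close> than \<open>v\<close> is,
so the walk cannot meet \<open>v\<close>.
\<close>

lemma avoiding_walk:
  assumes "z \<in> pverts G" "v \<in> pverts G" "w \<in> pverts G" "w \<noteq> v" "d z w \<le> d z v"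
  shows "\<exists>p. awalk z p w \<and> (\<forall>e\<in>set p. fst e \<noteq> v \<and> snd e \<noteq> v)"
  using assms(3-)
proof (induction "d z w" arbitrary: w rule: less_induct)
  case less
  show ?case
  proof (cases "w = z")
    case True
    then show ?thesis using assms by (intro exI[of _ "[]"]) (auto simp: awalk_Nil_iff)
  next
    case False
    then obtain w' where w': "w' \<in> pverts G" "(w', w) \<in> parcs G" "d z w' + 1 = d z w"
      using last_step assms less.prems by metis
    then have nv: "w' \<noteq> v" using less.prems by auto
    obtain p where p: "awalk z p w'" "\<forall>e\<in>set p. fst e \<noteq> v \<and> snd e \<noteq> v"
      using less.hyps[of w'] w' nv less.prems by auto
    have "awalk z (p @ [(w', w)]) w"
      using p w' less.prems by (auto intro!: awalk_appendI simp: awalk_simps)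
    then show ?thesis using p nv less.prems by (intro exI[of _ "p @ [(w', w)]"]) auto
  qed
qed

text \<open>
Two neighbours of \<open>v\<close> that are no farther from \<open>z\<close> than \<open>v\<close> could be joined via \<open>z\<close> without passing
through \<open>v\<close>, which would close a cycle through \<open>v\<close>. Acyclicity enters the later arguments about
distances only through this lemma.
\<close>

lemma unique_nearer_neighbour:
  assumes z: "z \<in> pverts G" and arcs: "(v, w) \<in> parcs G" "(v, w') \<in> parcs G"
    and near: "d z w \<le> d z v" "d z w' \<le> d z v"
  shows "w = w'"
proof (rule ccontr)
  assume neq: "w \<noteq> w'"
  have V: "v \<in> pverts G" "w \<in> pverts G" "w' \<in> pverts G"
    using arcs in_arcsD1 in_arcsD2 by auto
  have nv: "w \<noteq> v" "w' \<noteq> v" using arcs no_loops' by auto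
  obtain p where p: "awalk z p w" "\<forall>e\<in>set p. fst e \<noteq> v \<and> snd e \<noteq> v"
    using avoiding_walk[of z v w] z V nv near by blast
  obtain p' where p': "awalk z p' w'" "\<forall>e\<in>set p'. fst e \<noteq> v \<and> snd e \<noteq> v"
    using avoiding_walk[of z v w'] z V nv near by blast
  have rev: "set (rev_path q) = (\<lambda>e. (snd e, fst e)) ` set q" for q :: "('a \<times> 'a) list"
    by (induction q) auto
  define r where "r = awalk_to_apath (rev_path p @ p')"
  have w: "awalk w (rev_path p @ p') w'"
    using p p' by (auto intro!: awalk_appendI)
  have r: "apath w r w'" and sub: "set r \<subseteq> set (rev_path p @ p')"
    using apath_awalk_to_apath[OF w] awalk_to_apath_subset[OF w] by (simp_all add: r_def)
  have av: "\<forall>e\<in>set r. fst e \<noteq> v \<and> snd e \<noteq> v"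
  proof
    fix e assume "e \<in> set r"
    then have "e \<in> (\<lambda>e. (snd e, fst e)) ` set p \<union> set p'" using sub by (auto simp: rev)
    then show "fst e \<noteq> v \<and> snd e \<noteq> v" using p(2) p'(2) by auto
  qed
  have rw: "awalk w r w'" and rd: "distinct (pawalk_verts w r)"
    using r by (auto simp: apath_def)
  have rne: "r \<noteq> []" using rw neq by (auto simp: awalk_Nil_iff)
  have vr: "v \<notin> set (pawalk_verts w r)"
    using set_awalk_verts_not_Nil[OF rw rne] av by auto
  have app: "pawalk_verts w (r @ [(w', v)]) = pawalk_verts w r @ [v]"
    using rw awalk_verts_append[of w r "[(w', v)]" v] V arcs arcs_symmetric
    by (auto simp: awalk_simps)
  \<comment> \<open>The forbidden cycle: from \<open>v\<close> to \<open>w\<close>, along \<open>r\<close> to \<open>w'\<close>, and back to \<open>v\<close>.\<close>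
  let ?c = "(v, w) # r @ [(w', v)]"
  have "awalk v ?c v"
    using rw V arcs arcs_symmetric by (auto simp: awalk_simps)
  moreover have "distinct (tl (pawalk_verts v ?c))"
    using app rd vr by simp
  ultimately have "cycle ?c" unfolding cycle_def by blast
  then have "length ?c < 3" by (rule acyclic)
  then show False using rne by (cases r) auto
qed

end

lemma is_tree_iff_tree_graph: "is_tree G \<longleftrightarrow> tree_graph G"
proof
  assume T: "is_tree G"
  then interpret connected_graph G by (rule is_tree_connected_graph)
  show "tree_graph G"
    using T unfolding is_tree_def by unfold_locales (auto simp: not_le)
next
  assume "tree_graph G"
  then interpret tree_graph G .
  show "is_tree G"
    unfolding is_tree_def using connected acyclic by (auto simp: not_le[symmetric])
qed

context connected_graph
begin

lemma geodesic_point: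
  assumes "z \<in> pverts G" "v \<in> pverts G" "k \<le> d z v"
  obtains u where "u \<in> pverts G" "d z u = k" "d u v = d z v - k"
proof -
  have "\<exists>u\<in>pverts G. d z u = k \<and> d u v = d z v - k"
    using assms(2,3)
  proof (induction "d z v" arbitrary: v)
    case 0
    then show ?case using assms(1) by (intro bexI[of _ v]) auto
  next
    case (Suc n)
    show ?case
    proof (cases "k = Suc n")
      case True
      then show ?thesis using Suc by (intro bexI[of _ v]) auto
    next
      case False
      have "z \<noteq> v" using Suc by auto
      then obtain w where w: "w \<in> pverts G" "(w, v) \<in> parcs G" "d z w + 1 = d z v"
        using last_step assms(1) Suc.prems by metis
      then obtain u where u: "u \<in> pverts G" "d z u = k" "d u w = d z w - k"
        using Suc.hyps(1)[of w] Suc.hyps(2) Suc.prems False by auto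
      have "d u v \<le> d u w + 1" using arc_dist_le[OF u(1) w(2)] by simp
      moreover have "d z v \<le> d z u + d u v"
        using dist_triangle[of z u v] assms(1) u(1) Suc.prems by simp
      ultimately have "d u v = d z v - k"
        using u(2,3) w(3) Suc.hyps(2) Suc.prems(2) False by linarith
      then show ?thesis using u by blast
    qed
  qed
  then show ?thesis using that by blast
qed

lemma eccentricity_eqI:
  assumes "\<And>u. u \<in> pverts G \<Longrightarrow> d v u \<le> k" "u \<in> pverts G" "d v u = k"
  shows "eccentricity G v = k"
  unfolding eccentricity_def using assms pair_finite_verts by (intro Max_eqI) auto

end

context tree_graph
begin

lemma arc_dist_cases:
  assumes z: "z \<in> pverts G" and arc: "(v, w) \<in> parcs G"
  shows "d z w = d z v + 1 \<or> d z v = d z w + 1"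
proof -
  have V: "v \<in> pverts G" "w \<in> pverts G" using arc in_arcsD1 in_arcsD2 by auto
  have "d z v \<noteq> d z w"
  proof
    assume eq: "d z v = d z w"
    have "z \<noteq> v" using eq dist_eq_0_iff[of z] z V no_loops'[OF arc] by auto
    then obtain u where u: "(u, v) \<in> parcs G" "d z u + 1 = d z v"
      using last_step z V by metis
    then have "u = w" using unique_nearer_neighbour[OF z, of v u w] arc eq arcs_symmetric by auto
    then show False using u eq by simp
  qed
  then show ?thesis using arc_dist_le[OF z arc] by linarith
qed

text \<open>
In a tree the union of two shortest paths that overlap in one arc is again a shortest path: once the
distance from \<open>z\<close> has grown in the step from \<open>w\<close> to \<open>v\<close>, it must grow in every further step, since a
vertex has at most one neighbour that is not farther from \<open>z\<close>.
\<close>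

lemma dist_across_arc:
  assumes z: "z \<in> pverts G" and x: "x \<in> pverts G" and arc: "(w, v) \<in> parcs G"
    and "d z w < d z v" "d v x < d w x"
  shows "d z x = d z w + 1 + d v x"
  using assms(3-)
proof (induction "d v x" arbitrary: v w)
  case 0
  then have "v = x" using dist_eq_0_iff x in_arcsD2 by metis
  then show ?case using arc_dist_cases[OF z 0(2)] 0 by auto
next
  case (Suc n)
  have V: "v \<in> pverts G" "w \<in> pverts G" using Suc.prems in_arcsD1 in_arcsD2 by auto
  have "v \<noteq> x" using Suc.hyps(2) V by auto
  then obtain v' where v': "v' \<in> pverts G" "(v', v) \<in> parcs G" "d x v' + 1 = d x v"
    using last_step[of x v] x V by metis
  have v'x: "d v' x + 1 = d v x" using v' dist_sym x V by metis
  have "v' \<noteq> w" using v'x Suc.prems by auto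
  then have "d z v < d z v'"
    using unique_nearer_neighbour[OF z, of v v' w] v' Suc.prems arcs_symmetric
    by (meson leI less_imp_le_nat)
  moreover have "(v, v') \<in> parcs G" using v' arcs_symmetric by blast
  ultimately have "d z x = d z v + 1 + d v' x"
    using Suc.hyps(1)[of v' v] Suc.hyps(2) v'x by simp
  then show ?case using arc_dist_cases[OF z Suc.prems(1)] Suc.prems v'x by auto
qed

text \<open>
A tree is bipartite: along an arc every distance changes by exactly one.
\<close>

lemma dist_parity:
  assumes z: "z \<in> pverts G" and u: "u \<in> pverts G" and v: "v \<in> pverts G"
  shows "even (d u v + d z u + d z v)"
  using v
proof (induction "d u v" arbitrary: v)
  case 0
  then show ?case using dist_eq_0_iff u by force
next
  case (Suc n)
  have "u \<noteq> v" using Suc by auto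
  then obtain w where w: "w \<in> pverts G" "(w, v) \<in> parcs G" "d u w + 1 = d u v"
    using last_step u Suc.prems by metis
  have "even (d u w + d z u + d z w)" using Suc w by auto
  moreover have "d z v = d z w + 1 \<or> d z w = d z v + 1" using arc_dist_cases[OF z w(2)] .
  ultimately show ?case using w(3) by (smt (verit) even_add odd_one)
qed

lemma geodesic_point_unique:
  assumes z: "z \<in> pverts G" and v: "v \<in> pverts G"
    and u: "u \<in> pverts G" "d z u + d u v = d z v"
    and u': "u' \<in> pverts G" "d z u' + d u' v = d z v"
    and eq: "d u v = d u' v"
  shows "u = u'"
  using v u(2) u'(2) eq
proof (induction "d u v" arbitrary: v)
  case 0
  then show ?case using dist_eq_0_iff u(1) u'(1) by metis
next
  case (Suc n)
  have nearer: "\<exists>w\<in>pverts G. (w, v) \<in> parcs G \<and> d s w + 1 = d s v \<and> d z s + d s w = d z w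
      \<and> d z w + 1 = d z v" if s: "s \<in> pverts G" "d z s + d s v = d z v" "d s v \<noteq> 0" for s
  proof -
    have "s \<noteq> v" using s Suc.prems by auto
    then obtain w where w: "w \<in> pverts G" "(w, v) \<in> parcs G" "d s w + 1 = d s v"
      using last_step s Suc.prems by metis
    have "d z w \<le> d z s + d s w" using dist_triangle z s w by simp
    moreover have "d z v \<le> d z w + 1" using arc_dist_le[OF z w(2)] by simp
    ultimately show ?thesis using w s by (intro bexI[of _ w]) auto
  qed
  obtain w where w: "w \<in> pverts G" "(w, v) \<in> parcs G" "d u w + 1 = d u v"
      "d z u + d u w = d z w" "d z w + 1 = d z v"
    using nearer[OF u(1)] Suc by auto
  obtain w' where w': "w' \<in> pverts G" "(w', v) \<in> parcs G" "d u' w' + 1 = d u' v"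
      "d z u' + d u' w' = d z w'" "d z w' + 1 = d z v"
    using nearer[OF u'(1)] Suc by auto
  have "w = w'"
    using unique_nearer_neighbour[OF z, of v w w'] w w' arcs_symmetric by auto
  then have "n = d u w" "d u w = d u' w" "d z u' + d u' w = d z w"
    using Suc.hyps(2) Suc.prems(4) w w' by simp_all
  then show ?case using Suc.hyps(1)[of w] w by blast
qed

end

section \<open>Levels around the centre\<close>

text \<open>
A tree with the data of a longest path from \<open>x\<close> to \<open>y\<close>, whose length is \<open>2 * h + \<delta>\<close>. The arc from \<open>c\<close> to
\<open>q\<close> is the step of this path that starts at distance \<open>h\<close> from \<open>x\<close>. For \<open>\<delta> = 1\<close> its two ends are the
centre of the tree; for \<open>\<delta> = 0\<close> the centre is \<open>c\<close> alone.
\<close>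

locale centred_tree = tree_graph +
  fixes c q x y :: 'a and h \<delta> :: nat
  assumes centre_arc: "(c, q) \<in> parcs G"
    and ends: "x \<in> pverts G" "y \<in> pverts G"
    and diameter: "\<And>u v. u \<in> pverts G \<Longrightarrow> v \<in> pverts G \<Longrightarrow> d u v \<le> 2 * h + \<delta>"
    and dist_x: "d c x = h" "d q x = h + 1"
    and dist_y: "d c y = h + \<delta>" "d q y + 1 = h + \<delta>"
    and parity_le: "\<delta> \<le> 1"
    and radius_pos: "1 \<le> h"
begin

lemma cq_verts [simp]: "c \<in> pverts G" "q \<in> pverts G"
  using centre_arc in_arcsD1 in_arcsD2 by auto

lemma dist_cq [simp]: "d c q = 1" "d q c = 1"
  using dist_eq_1_iff centre_arc arcs_symmetric by auto

definition far :: "'a \<Rightarrow> bool" where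
  "far v \<longleftrightarrow> d q v < d c v"

text \<open>
The distance to the centre. For \<open>\<delta> = 1\<close> a vertex beyond \<open>q\<close> is measured from the centre vertex \<open>q\<close>,
one step nearer than \<open>c\<close>; for \<open>\<delta> = 0\<close> both sides are measured from \<open>c\<close>.
\<close>

definition lev :: "'a \<Rightarrow> nat" where
  "lev v = (if far v then d c v - \<delta> else d c v)"

definition level :: "nat \<Rightarrow> 'a set" where
  "level i = {v \<in> pverts G. lev v = i}"

lemma dist_q:
  assumes "v \<in> pverts G"
  shows "far v \<Longrightarrow> d c v = d q v + 1" "\<not> far v \<Longrightarrow> d q v = d c v + 1"
  using arc_dist_cases[OF assms centre_arc] dist_sym[OF assms, of c] dist_sym[OF assms, of q]
  by (auto simp: far_def)

lemma dist_c_lev: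
  assumes "v \<in> pverts G"
  shows "d c v = (if far v then lev v + \<delta> else lev v)" "far v \<Longrightarrow> 1 \<le> lev v + \<delta>"
  using dist_q[OF assms] parity_le by (auto simp: lev_def)

lemma dist_cross:
  assumes "u \<in> pverts G" "v \<in> pverts G" "\<not> far u" "far v"
  shows "d u v = lev u + lev v + \<delta>"
proof -
  have "d u v = d u c + 1 + d q v"
  proof (rule dist_across_arc[OF assms(1,2) centre_arc])
    show "d u c < d u q"
      using dist_q(2)[OF assms(1,3)] dist_sym[OF assms(1), of c] dist_sym[OF assms(1), of q] by simp
    show "d q v < d c v" using assms(4) by (simp add: far_def)
  qed
  then show ?thesis
    using dist_q(1)[OF assms(2,4)] dist_c_lev(1)[OF assms(1)] dist_c_lev(1)[OF assms(2)]
      dist_sym[OF assms(1), of c] assms(3,4) by simp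
qed

lemma dist_cross':
  assumes "u \<in> pverts G" "v \<in> pverts G" "far u \<noteq> far v"
  shows "d u v = lev u + lev v + \<delta>"
  using dist_cross[of u v] dist_cross[of v u] assms dist_sym[of u v] by auto

lemma near_x: "\<not> far x" and near_c: "\<not> far c" and far_q: "far q" and far_y: "far y"
  using dist_x dist_y by (auto simp: far_def)

lemma lev_ends [simp]: "lev c = 0" "lev x = h" "lev y = h" "lev q = 1 - \<delta>"
  using dist_x dist_y near_x near_c far_q far_y by (auto simp: lev_def)

text \<open>
The end of the longest path on the opposite side is at level \<open>h\<close>, so a vertex of larger level would
be farther than the diameter from it.
\<close>

lemma lev_le:
  assumes "v \<in> pverts G"
  shows "lev v \<le> h"
  using dist_cross'[of v x] dist_cross'[of v y] diameter[of v x] diameter[of v y]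
    assms ends near_x far_y by (cases "far v") auto

lemma lev_eq_0_iff:
  assumes "v \<in> pverts G"
  shows "lev v = 0 \<longleftrightarrow> v = c \<or> \<delta> = 1 \<and> v = q"
proof
  assume l: "lev v = 0"
  show "v = c \<or> \<delta> = 1 \<and> v = q"
  proof (cases "far v")
    case True
    then have "\<delta> = 1" "d q v = 0" using dist_c_lev[OF assms] dist_q[OF assms] l parity_le by auto
    then show ?thesis using dist_eq_0_iff assms by auto
  next
    case False
    then show ?thesis using dist_c_lev[OF assms] l dist_eq_0_iff[of c v] assms by auto
  qed
next
  assume "v = c \<or> \<delta> = 1 \<and> v = q"
  then show "lev v = 0" using lev_ends(1,4) by (metis diff_self_eq_0)
qed

lemma dist_le_lev:
  assumes "u \<in> pverts G" "v \<in> pverts G"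
  shows "d u v \<le> lev u + lev v + \<delta>"
proof (cases "far u = far v")
  case True
  show ?thesis
  proof (cases "far v")
    case True
    have "d u v \<le> d q u + d q v" using dist_triangle[of u q v] dist_sym[of u q] assms by simp
    moreover have "d q u + 1 = lev u + \<delta>" "d q v + 1 = lev v + \<delta>"
      using dist_q(1)[OF assms(1)] dist_q(1)[OF assms(2)] dist_c_lev(1)[OF assms(1)]
        dist_c_lev(1)[OF assms(2)] True \<open>far u = far v\<close> by simp_all
    ultimately show ?thesis using parity_le by linarith
  next
    case False
    have "d u v \<le> d c u + d c v" using dist_triangle[of u c v] dist_sym[of u c] assms by simp
    then show ?thesis
      using dist_c_lev(1)[OF assms(1)] dist_c_lev(1)[OF assms(2)] False True by simp
  qed
qed (use dist_cross' assms in simp)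

text \<open>
A farthest vertex is the end of the longest path on the opposite side. This is the reason why the
eccentric sequence records exactly the sizes of the levels.
\<close>

lemma eccentricity_lev:
  assumes "v \<in> pverts G"
  shows "eccentricity G v = lev v + h + \<delta>"
proof (rule eccentricity_eqI)
  show "d v u \<le> lev v + h + \<delta>" if "u \<in> pverts G" for u
    using dist_le_lev[OF assms that] lev_le[OF that] by simp
  show "(if far v then x else y) \<in> pverts G" using ends by simp
  show "d v (if far v then x else y) = lev v + h + \<delta>"
    using dist_cross'[of v x] dist_cross'[of v y] assms ends near_x far_y by auto
qed

lemma geodesic_side:
  assumes "u \<in> pverts G" "v \<in> pverts G" "d c u + d u v = d c v" "d c u \<noteq> 0"
  shows "far u \<longleftrightarrow> far v"
proof (rule ccontr)
  assume n: "far u \<noteq> far v"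
  have "d u v = d c u + d c v"
    using dist_cross'[OF assms(1,2) n] dist_c_lev(1)[OF assms(1)] dist_c_lev(1)[OF assms(2)] n
    by (cases "far u") simp_all
  then show False using assms by simp
qed

text \<open>
The difference of the levels is the smallest conceivable distance; it is attained precisely when \<open>u\<close>
lies between \<open>c\<close> and \<open>v\<close>. In the second disjunct \<open>u\<close> is the only centre vertex, which belongs to
the near side but is an ancestor of the far vertices too.
\<close>

lemma dist_eq_lev_diff_iff:
  assumes "u \<in> pverts G" "v \<in> pverts G" "lev u \<le> lev v"
  shows "d u v = lev v - lev u \<longleftrightarrow> d c u + d u v = d c v \<and> (far u = far v \<or> lev u + \<delta> = 0)"
proof (cases "far u = far v")
  case True
  then show ?thesis using dist_c_lev(1)[OF assms(1)] dist_c_lev(1)[OF assms(2)] assms(3) by auto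
next
  case False
  then show ?thesis
    using dist_cross'[OF assms(1,2)] dist_c_lev(1)[OF assms(1)] dist_c_lev(1)[OF assms(2)] assms(3)
    by (auto split: if_splits)
qed

text \<open>
The side condition \<open>0 < i + \<delta>\<close> excludes the case of a single centre vertex, where a far vertex has its
ancestor of level \<open>0\<close> on the near side.
\<close>

lemma ancestor_exists:
  assumes v: "v \<in> pverts G" and i: "i \<le> lev v" "0 < i + \<delta>"
  obtains u where "u \<in> pverts G" "lev u = i" "far u = far v" "d u v = lev v - i"
proof -
  \<comment> \<open>The distance from \<open>c\<close> that belongs to level \<open>i\<close> on the side of \<open>v\<close>.\<close>
  define k where "k = (if far v then i + \<delta> else i)"
  have k: "k \<le> d c v" using i dist_c_lev[OF v] by (auto simp: k_def)
  then obtain u where u: "u \<in> pverts G" "d c u = k" "d u v = d c v - k"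
    using geodesic_point[of c v k] v by auto
  have side: "far u = far v"
  proof (cases "k = 0")
    case True
    then show ?thesis using u i near_c dist_eq_0_iff[of c u] by (auto simp: k_def split: if_splits)
  next
    case False
    then show ?thesis using geodesic_side[OF u(1) v] u k by simp
  qed
  have "lev u = i" using dist_c_lev(1)[OF u(1)] side u(2) by (auto simp: k_def split: if_splits)
  moreover have "d u v = lev v - i"
    using u(3) dist_c_lev(1)[OF v] by (cases "far v") (simp_all add: k_def)
  ultimately show ?thesis using that u(1) side by blast
qed

lemma ancestor_unique:
  assumes v: "v \<in> pverts G" and u: "u \<in> pverts G" "d u v = lev v - lev u"
    and u': "u' \<in> pverts G" "d u' v = lev v - lev u'"
    and lev: "lev u = lev u'" "lev u \<le> lev v"
  shows "u = u'"
proof (rule geodesic_point_unique[OF cq_verts(1) v u(1) _ u'(1)])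
  show "d c u + d u v = d c v" using dist_eq_lev_diff_iff[OF u(1) v] u(2) lev by blast
  show "d c u' + d u' v = d c v"
    using dist_eq_lev_diff_iff[OF u'(1) v] u'(2) lev(1) lev(2)[unfolded lev(1)] by blast
  show "d u v = d u' v" using u(2) u'(2) lev(1) by metis
qed

text \<open>
Inside one side the parity of the distance is that of the difference of the levels, so the value just
above the minimum is skipped.
\<close>

lemma same_side_dist:
  assumes "u \<in> pverts G" "v \<in> pverts G" "far u = far v" "lev u \<le> lev v"
    and neq: "d u v \<noteq> lev v - lev u"
  shows "lev v - lev u + 2 \<le> d u v"
proof -
  have "d c v \<le> d c u + d u v" using dist_triangle assms by simp
  then have ge: "lev v - lev u < d u v"
    using neq dist_c_lev(1)[OF assms(1)] dist_c_lev(1)[OF assms(2)] assms(3) by (auto split: if_splits)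
  have "even (d u v + d c u + d c v)" using dist_parity assms by simp
  then have "even (d u v + lev u + lev v)"
    using dist_c_lev(1)[OF assms(1)] dist_c_lev(1)[OF assms(2)] assms(3) by (auto split: if_splits)
  then show ?thesis using ge assms(4) by presburger
qed

lemma arc_lev_cases:
  assumes arc: "(u, v) \<in> parcs G"
  shows "lev v = lev u + 1 \<or> lev u = lev v + 1 \<or> \<delta> = 1 \<and> (u = c \<and> v = q \<or> u = q \<and> v = c)"
proof -
  have V: "u \<in> pverts G" "v \<in> pverts G" using arc in_arcsD1 in_arcsD2 by auto
  show ?thesis
  proof (cases "far u = far v")
    case True
    then show ?thesis
      using arc_dist_cases[OF cq_verts(1) arc] dist_c_lev(1)[OF V(1)] dist_c_lev(1)[OF V(2)]
      by (auto split: if_splits)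
  next
    case False
    have "d u v = 1" using dist_eq_1_iff arc V by simp
    then have 1: "lev u + lev v + \<delta> = 1" using dist_cross'[OF V False] by simp
    show ?thesis
    proof (cases "\<delta> = 1")
      case True
      then show ?thesis using 1 lev_eq_0_iff[OF V(1)] lev_eq_0_iff[OF V(2)] no_loops'[OF arc] by auto
    next
      case False
      then have "\<delta> = 0" using parity_le by linarith
      then have "lev v = lev u + 1 \<or> lev u = lev v + 1" using 1 by arith
      then show ?thesis by blast
    qed
  qed
qed

lemma finite_level [simp]: "finite (level i)"
  using pair_finite_verts by (simp add: level_def)

lemma level_0: "level 0 = (if \<delta> = 1 then {c, q} else {c})"
  using lev_eq_0_iff by (auto simp: level_def)

lemma side_nonempty:
  assumes "i \<le> h" "0 < i + \<delta>"
  shows "\<exists>u\<in>level i. far u = b"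
proof -
  have xy: "(if b then y else x) \<in> pverts G" "lev (if b then y else x) = h"
    "far (if b then y else x) = b" using ends near_x far_y by auto
  obtain u where "u \<in> pverts G" "lev u = i" "far u = b"
    using ancestor_exists[OF xy(1), of i] xy(2,3) assms by metis
  then show ?thesis by (auto simp: level_def)
qed

end

text \<open>
With more than two vertices the diameter is at least \<open>2\<close>, for otherwise three vertices would be pairwise
adjacent.
\<close>

lemma (in tree_graph) centred_tree_exists:
  assumes "2 < card (pverts G)"
  obtains c q x y h \<delta> where "centred_tree G c q x y h \<delta>"
proof -
  let ?P = "pverts G \<times> pverts G"
  define D where "D = Max ((\<lambda>(u, v). d u v) ` ?P)"
  have fin: "finite ?P" and ne: "?P \<noteq> {}" using pair_finite_verts verts_nonempty by auto
  have le: "d u v \<le> D" if "u \<in> pverts G" "v \<in> pverts G" for u v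
    unfolding D_def using fin that by (intro Max_ge) auto
  have "D \<in> (\<lambda>(u, v). d u v) ` ?P" unfolding D_def using fin ne by (intro Max_in) auto
  then obtain x y where xy: "x \<in> pverts G" "y \<in> pverts G" "d x y = D" by auto
  have "2 \<le> D"
  proof (rule ccontr)
    assume "\<not> 2 \<le> D"
    then have adj: "d u v = 1" if "u \<in> pverts G" "v \<in> pverts G" "u \<noteq> v" for u v
      using le[OF that(1,2)] dist_eq_0_iff[OF that(1,2)] that(3) by linarith
    have "\<exists>S\<subseteq>pverts G. card S = 3" using assms
      by (metis Suc_leI numeral_3_eq_3 obtain_subset_with_card_n numeral_2_eq_2)
    then obtain u v w where uvw: "u \<in> pverts G" "v \<in> pverts G" "w \<in> pverts G"
      "u \<noteq> v" "v \<noteq> w" "u \<noteq> w" by (auto simp: card_3_iff)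
    then have "(v, w) \<in> parcs G" using adj dist_eq_1_iff by metis
    then show False using arc_dist_cases[of u v w] uvw adj[of u v] adj[of u w] by auto
  qed
  define h where "h = D div 2"
  define \<delta> where "\<delta> = D mod 2"
  have D: "D = 2 * h + \<delta>" "\<delta> \<le> 1" "1 \<le> h" using \<open>2 \<le> D\<close> by (auto simp: h_def \<delta>_def)
  \<comment> \<open>The arc that follows the first \<open>h\<close> steps of the path; for odd diameter it is the middle one.\<close>
  obtain q where q: "q \<in> pverts G" "d x q = h + 1" "d q y = D - (h + 1)"
    using geodesic_point[of x y "h + 1"] xy D by auto
  have "x \<noteq> q" using q xy by auto
  then obtain c where c: "c \<in> pverts G" "(c, q) \<in> parcs G" "d x c + 1 = d x q"
    using last_step xy q by metis
  have "d c y = h + \<delta>"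
  proof -
    have "D \<le> d x c + d c y" using dist_triangle[of x c y] xy c by simp
    moreover have "d y c \<le> d y q + 1" using arc_dist_le[OF xy(2) c(2)] by simp
    ultimately show ?thesis using c q D xy dist_sym[of y c] dist_sym[of y q] by simp
  qed
  then have "centred_tree G c q x y h \<delta>"
    using c q D xy le dist_sym[of x c] dist_sym[of x q] by unfold_locales auto
  then show ?thesis using that by blast
qed

section \<open>An upper bound from the sizes of the levels\<close>

text \<open>
The sum of \<open>f\<close> over the distances between level \<open>i\<close> and level \<open>j \<ge> i\<close> in the extremal tree, where \<open>n\<close>
gives the sizes of the levels: one ancestor for each vertex of level \<open>j\<close>, as few pairs on different
sides as possible, and all other pairs at distance \<open>j - i + 2\<close>. In the first case level \<open>i\<close> consists of
a single centre vertex, which has distance \<open>j\<close> from all of level \<open>j\<close>.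
\<close>

definition level_pair_bound :: "(nat \<Rightarrow> real) \<Rightarrow> nat \<Rightarrow> (nat \<Rightarrow> nat) \<Rightarrow> nat \<Rightarrow> nat \<Rightarrow> real" where
  "level_pair_bound f \<delta> n i j =
    (if i + \<delta> = 0 then n j * f j
     else n j * f (j - i) + (real (n i) + n j - 2) * f (i + j + \<delta>)
       + (real (n i) - 2) * (real (n j) - 1) * f (j - i + 2))"

definition level_bound :: "(nat \<Rightarrow> real) \<Rightarrow> nat \<Rightarrow> nat \<Rightarrow> (nat \<Rightarrow> nat) \<Rightarrow> real" where
  "level_bound f h \<delta> n =
    (\<Sum>i\<le>h. \<Sum>j\<le>h. level_pair_bound f \<delta> n (min i j) (max i j))"

text \<open>
Ordered pairs are easier to distribute over the pairs of levels than the two-element sets of the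
indices. The diagonal contributes nothing for a weight with \<open>f 0 = 0\<close>.
\<close>

definition dist_sum :: "(nat \<Rightarrow> real) \<Rightarrow> 'a pair_pre_digraph \<Rightarrow> real" where
  "dist_sum f G = (\<Sum>u\<in>pverts G. \<Sum>v\<in>pverts G. f (gdist G u v))"

locale decreasing_weight =
  fixes f :: "nat \<Rightarrow> real"
  assumes zero: "f 0 = 0"
    and decreasing: "0 < k \<Longrightarrow> k < m \<Longrightarrow> f m < f k"
begin

lemma antimono: "0 < k \<Longrightarrow> k \<le> m \<Longrightarrow> f m \<le> f k"
  using decreasing[of k m] by (cases "k = m") auto

end

lemma sum_constant_on:
  fixes g :: "'a \<Rightarrow> real" and k :: real
  assumes "\<And>p. p \<in> A \<Longrightarrow> g p = k"
  shows "sum g A = card A * k"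
  using assms by simp

lemma sum_three_parts:
  assumes "finite P" "A \<subseteq> P" "B \<subseteq> P" "A \<inter> B = {}"
  shows "sum g P = sum g A + sum g B + sum g (P - A - B)"
proof -
  have "finite A" "finite B"
    using assms(1) finite_subset[OF assms(2)] finite_subset[OF assms(3)] by simp_all
  then have "sum g (A \<union> B) = sum g A + sum g B" using assms(4) by (rule sum.union_disjoint)
  moreover have "sum g P = sum g (P - (A \<union> B)) + sum g (A \<union> B)"
    using assms by (intro sum.subset_diff) auto
  ultimately show ?thesis by (simp add: Diff_eq Int_assoc add.commute)
qed

locale weighted_centred_tree = centred_tree G c q x y h \<delta> + decreasing_weight f
  for G :: "'a pair_pre_digraph" and c q x y h \<delta> f
begin

definition near_count :: "nat \<Rightarrow> nat" where
  "near_count i = card {u \<in> level i. \<not> far u}"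

definition far_count :: "nat \<Rightarrow> nat" where
  "far_count i = card {u \<in> level i. far u}"

lemma level_card: "card (level i) = near_count i + far_count i"
proof -
  have "card ({u \<in> level i. \<not> far u} \<union> {u \<in> level i. far u})
      = near_count i + far_count i"
    unfolding near_count_def far_count_def by (intro card_Un_disjoint) auto
  moreover have "{u \<in> level i. \<not> far u} \<union> {u \<in> level i. far u} = level i" by auto
  ultimately show ?thesis by simp
qed

lemma side_counts_pos:
  assumes "i \<le> h" "0 < i + \<delta>"
  shows "1 \<le> near_count i" "1 \<le> far_count i"
  using side_nonempty[OF assms, of False] side_nonempty[OF assms, of True]
  by (auto simp: near_count_def far_count_def Suc_le_eq card_gt_0_iff)

abbreviation level_pairs :: "nat \<Rightarrow> nat \<Rightarrow> ('a \<times> 'a) set" where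
  "level_pairs i j \<equiv> level i \<times> level j"

definition vertical_pairs :: "nat \<Rightarrow> nat \<Rightarrow> ('a \<times> 'a) set" where
  "vertical_pairs i j = {(u, v) \<in> level_pairs i j. d u v = j - i}"

definition cross_pairs :: "nat \<Rightarrow> nat \<Rightarrow> ('a \<times> 'a) set" where
  "cross_pairs i j = {(u, v) \<in> level_pairs i j. far u \<noteq> far v}"

text \<open>
Pairs on one side of which neither vertex is an ancestor of the other.
\<close>

definition skew_pairs :: "nat \<Rightarrow> nat \<Rightarrow> ('a \<times> 'a) set" where
  "skew_pairs i j = level_pairs i j - vertical_pairs i j - cross_pairs i j"

lemma card_vertical_pairs:
  assumes "i \<le> j" "0 < i + \<delta>"
  shows "card (vertical_pairs i j) = card (level j)"
proof (rule bij_betw_same_card[of snd], rule bij_betw_imageI)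
  show "inj_on snd (vertical_pairs i j)"
  proof (rule inj_onI)
    fix p p' assume p: "p \<in> vertical_pairs i j" "p' \<in> vertical_pairs i j" and eq: "snd p = snd p'"
    obtain u v u' where pv: "p = (u, v)" "p' = (u', v)" using eq by (metis prod.collapse)
    have u: "u \<in> pverts G" "lev u = i" "d u v = j - i" and u': "u' \<in> pverts G" "lev u' = i" "d u' v = j - i"
      and v: "v \<in> pverts G" "lev v = j"
      using p unfolding pv vertical_pairs_def level_def by blast+
    have "u = u'"
      by (rule ancestor_unique[OF v(1) u(1) _ u'(1)]) (simp_all only: u u' v assms(1))
    then show "p = p'" by (simp add: pv)
  qed
  show "snd ` vertical_pairs i j = level j"
  proof
    show "level j \<subseteq> snd ` vertical_pairs i j"
    proof
      fix v assume v: "v \<in> level j"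
      obtain u where "u \<in> pverts G" "lev u = i" "d u v = lev v - i"
        using ancestor_exists[of v i] v assms by (auto simp: level_def)
      then have "(u, v) \<in> vertical_pairs i j"
        using v by (auto simp: vertical_pairs_def level_def)
      then show "v \<in> snd ` vertical_pairs i j" by force
    qed
  qed (auto simp: vertical_pairs_def)
qed

lemma card_cross_pairs:
  "card (cross_pairs i j) = near_count i * far_count j + far_count i * near_count j"
proof -
  let ?n = "\<lambda>i. {u \<in> level i. \<not> far u}" and ?f = "\<lambda>i. {u \<in> level i. far u}"
  have "cross_pairs i j = ?n i \<times> ?f j \<union> ?f i \<times> ?n j" by (auto simp: cross_pairs_def)
  moreover have "card (?n i \<times> ?f j \<union> ?f i \<times> ?n j) = card (?n i \<times> ?f j) + card (?f i \<times> ?n j)"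
    by (intro card_Un_disjoint) auto
  ultimately show ?thesis by (simp add: near_count_def far_count_def)
qed

lemma level_pairs_split:
  assumes "i \<le> j" "0 < i + \<delta>"
  shows "sum g (level_pairs i j)
      = sum g (vertical_pairs i j) + sum g (cross_pairs i j) + sum g (skew_pairs i j)"
proof -
  have disj: "vertical_pairs i j \<inter> cross_pairs i j = {}"
    using assms dist_cross' by (force simp: vertical_pairs_def cross_pairs_def level_def)
  show ?thesis
    unfolding skew_pairs_def using disj
    by (intro sum_three_parts) (auto simp: vertical_pairs_def cross_pairs_def)
qed

lemma skew_dist:
  assumes "(u, v) \<in> skew_pairs i j" "i \<le> j"
  shows "j - i + 2 \<le> d u v"
  using assms same_side_dist[of u v]
  by (auto simp: skew_pairs_def vertical_pairs_def cross_pairs_def level_def)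

text \<open>
This identity shows that the number of pairs on different sides is least when both levels have just
one vertex on the same side.
\<close>

lemma cross_excess:
  "near_count i * real (far_count j) + far_count i * real (near_count j)
    = real (card (level i)) + card (level j) - 2
      + (real (near_count i) - 1) * (real (far_count j) - 1)
      + (real (far_count i) - 1) * (real (near_count j) - 1)"
  by (simp add: level_card algebra_simps)

text \<open>
Two losses separate a tree from the bound: \<open>E\<close> surplus pairs on different sides, each of which has distance
\<open>i + j + \<delta>\<close> in place of \<open>j - i + 2\<close>, and the skew pairs farther apart than \<open>j - i + 2\<close>.
\<close>

lemma level_pair_sum:
  assumes ij: "i \<le> j" "j \<le> h" "0 < i + \<delta>"
  defines "E \<equiv> (real (near_count i) - 1) * (real (far_count j) - 1)
      + (real (far_count i) - 1) * (real (near_count j) - 1)"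
  shows "(\<Sum>(u, v)\<in>level_pairs i j. f (d u v))
    = level_pair_bound f \<delta> (\<lambda>i. card (level i)) i j
      - E * (f (j - i + 2) - f (i + j + \<delta>))
      - (\<Sum>(u, v)\<in>skew_pairs i j. f (j - i + 2) - f (d u v))"
proof -
  let ?n = "\<lambda>i. real (card (level i))"
  let ?X = "near_count i * real (far_count j) + far_count i * real (near_count j)"
  have cards: "?n i * ?n j = ?n j + ?X + card (skew_pairs i j)"
    using level_pairs_split[OF ij(1,3), of "\<lambda>_. 1 :: real"] card_vertical_pairs[OF ij(1,3)]
    by (simp add: card_cross_pairs card_cartesian_product)
  have v: "(\<Sum>(u, v)\<in>vertical_pairs i j. f (d u v)) = card (vertical_pairs i j) * f (j - i)"
    by (rule sum_constant_on) (auto simp: vertical_pairs_def)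
  have c: "(\<Sum>(u, v)\<in>cross_pairs i j. f (d u v)) = card (cross_pairs i j) * f (i + j + \<delta>)"
    by (rule sum_constant_on) (auto simp: cross_pairs_def level_def dist_cross')
  have s: "(\<Sum>(u, v)\<in>skew_pairs i j. f (d u v)) = card (skew_pairs i j) * f (j - i + 2)
      - (\<Sum>(u, v)\<in>skew_pairs i j. f (j - i + 2) - f (d u v))"
    by (simp add: sum_subtractf case_prod_unfold)
  have cX: "real (card (cross_pairs i j)) = ?X" by (simp add: card_cross_pairs)
  have pos: "i + \<delta> \<noteq> 0" using ij(3) by simp
  have sk: "real (card (skew_pairs i j)) = ?n i * ?n j - ?n j - ?X" using cards by simp
  have X: "?X = ?n i + ?n j - 2 + E" using cross_excess[of i j] unfolding E_def by simp
  show ?thesis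
    unfolding level_pairs_split[OF ij(1,3)] v c s sk card_vertical_pairs[OF ij(1,3)] cX X
      level_pair_bound_def if_not_P[OF pos]
    by (simp add: algebra_simps)
qed

lemma level_0_counts: "\<delta> = 1 \<Longrightarrow> near_count 0 = 1 \<and> far_count 0 = 1"
proof -
  assume "\<delta> = 1"
  then have "level 0 = {c, q}" unfolding level_0 by (rule if_P)
  then have "{u \<in> level 0. \<not> far u} = {c}" "{u \<in> level 0. far u} = {q}"
    using near_c far_q by auto
  then show ?thesis by (simp add: near_count_def far_count_def)
qed

lemma excess_nonneg:
  assumes "i \<le> j" "j \<le> h" "0 < i + \<delta>"
  shows "0 \<le> (real (near_count i) - 1) * (real (far_count j) - 1)"
    "0 \<le> (real (far_count i) - 1) * (real (near_count j) - 1)"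
  using side_counts_pos[of i] side_counts_pos[of j] assms by auto

text \<open>
For \<open>i \<ge> 1\<close> the difference of weights is nonnegative because \<open>j - i + 2 \<le> i + j + \<delta>\<close>. This inequality
fails for \<open>i = 0\<close> and \<open>\<delta> = 1\<close>, but then level \<open>i\<close> has one vertex on each side and there is no surplus.
\<close>

lemma excess_term_nonneg:
  assumes ij: "i \<le> j" "j \<le> h" "0 < i + \<delta>"
  shows "0 \<le> ((real (near_count i) - 1) * (real (far_count j) - 1)
      + (real (far_count i) - 1) * (real (near_count j) - 1))
      * (f (j - i + 2) - f (i + j + \<delta>))"
proof (cases "i = 0")
  case True
  then show ?thesis using ij level_0_counts parity_le by auto
next
  case False
  then have "f (i + j + \<delta>) \<le> f (j - i + 2)" using ij by (intro antimono) auto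
  then show ?thesis using excess_nonneg[OF ij] by (intro mult_nonneg_nonneg) auto
qed

lemma skew_term_nonneg:
  assumes "i \<le> j" "p \<in> skew_pairs i j"
  shows "0 \<le> (case p of (u, v) \<Rightarrow> f (j - i + 2) - f (d u v))"
proof -
  obtain u v where p: "p = (u, v)" by (cases p)
  then show ?thesis
    using skew_dist[of u v i j] antimono[of "j - i + 2" "d u v"] assms by simp
qed

lemma level_pair_sum_le:
  assumes ij: "i \<le> j" "j \<le> h"
  shows "(\<Sum>(u, v)\<in>level_pairs i j. f (d u v))
    \<le> level_pair_bound f \<delta> (\<lambda>i. card (level i)) i j"
proof (cases "i + \<delta> = 0")
  case True
  then have "i = 0" "\<delta> \<noteq> 1" by auto
  then have "level i = {c}" unfolding \<open>i = 0\<close> level_0 by (intro if_not_P)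
  then have "(\<Sum>(u, v)\<in>level_pairs i j. f (d u v)) = (\<Sum>v\<in>level j. f (d c v))"
    by (simp flip: sum.cartesian_product)
  also have "\<dots> = (\<Sum>v\<in>level j. f j)"
  proof (rule sum.cong)
    fix v assume "v \<in> level j"
    then have "d c v = j" using True dist_c_lev(1)[of v] by (simp add: level_def split: if_splits)
    then show "f (d c v) = f j" by simp
  qed simp
  finally show ?thesis using True by (simp add: level_pair_bound_def)
next
  case False
  then show ?thesis
    using level_pair_sum[OF ij] excess_term_nonneg[OF ij]
      sum_nonneg[OF skew_term_nonneg[OF ij(1)], of "skew_pairs i j" "\<lambda>p. p"] by simp
qed

text \<open>
The hypothesis \<open>2 < 2 * i + \<delta>\<close> says that \<open>j - i + 2 < i + j + \<delta>\<close>, so that a surplus pair on different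
sides really costs something. The levels it leaves out, which are level \<open>0\<close> and for \<open>\<delta> = 0\<close> also level
\<open>1\<close>, are adjacent to the centre or part of it, and there the shape of the tree leaves no choice.
\<close>

lemma tight_level_pair:
  assumes ij: "i \<le> j" "j \<le> h" and large: "2 < 2 * i + \<delta>"
    and tight: "(\<Sum>(u, v)\<in>level_pairs i j. f (d u v))
      = level_pair_bound f \<delta> (\<lambda>i. card (level i)) i j"
  shows "(near_count i = 1 \<or> far_count j = 1) \<and> (far_count i = 1 \<or> near_count j = 1)"
    "(u, v) \<in> skew_pairs i j \<Longrightarrow> d u v = j - i + 2"
proof -
  let ?a = "(real (near_count i) - 1) * (real (far_count j) - 1)"
  let ?b = "(real (far_count i) - 1) * (real (near_count j) - 1)"
  let ?s = "\<Sum>(u, v)\<in>skew_pairs i j. f (j - i + 2) - f (d u v)"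
  have pos: "0 < i + \<delta>" using large by auto
  have fin: "finite (skew_pairs i j)" by (simp add: skew_pairs_def)
  have s0: "0 \<le> ?s" using skew_term_nonneg[OF ij(1)] by (intro sum_nonneg)
  have e0: "0 \<le> (?a + ?b) * (f (j - i + 2) - f (i + j + \<delta>))"
    using excess_term_nonneg[OF ij pos] .
  have eqs: "?s = 0" "(?a + ?b) * (f (j - i + 2) - f (i + j + \<delta>)) = 0"
    using level_pair_sum[OF ij pos] tight s0 e0 by linarith+
  have "f (i + j + \<delta>) < f (j - i + 2)" using large ij by (intro decreasing) auto
  then have "?a + ?b = 0" using eqs(2) by simp
  then have "?a = 0" "?b = 0" using excess_nonneg[OF ij pos] by linarith+
  then show "(near_count i = 1 \<or> far_count j = 1) \<and> (far_count i = 1 \<or> near_count j = 1)"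
    by simp
  assume uv: "(u, v) \<in> skew_pairs i j"
  have "\<forall>p\<in>skew_pairs i j. (case p of (u, v) \<Rightarrow> f (j - i + 2) - f (d u v)) = 0"
    using sum_nonneg_eq_0_iff[OF fin, of "\<lambda>(u, v). f (j - i + 2) - f (d u v)"]
      skew_term_nonneg[OF ij(1)] eqs(1) by blast
  then have "f (d u v) = f (j - i + 2)" using uv by fastforce
  then show "d u v = j - i + 2"
    using skew_dist[OF uv ij(1)] decreasing[of "j - i + 2" "d u v"] by fastforce
qed

end

lemma sum_by_levels:
  fixes L :: "'a \<Rightarrow> nat" and g :: "'a \<Rightarrow> 'a \<Rightarrow> real"
  assumes "finite V" "\<And>v. v \<in> V \<Longrightarrow> L v \<le> h"
  shows "(\<Sum>u\<in>V. \<Sum>v\<in>V. g u v)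
    = (\<Sum>i\<le>h. \<Sum>j\<le>h. \<Sum>(u, v)\<in>{v \<in> V. L v = i} \<times> {v \<in> V. L v = j}. g u v)"
proof -
  have grp: "(\<Sum>i\<le>h. sum k {v \<in> V. L v = i}) = sum k V" for k :: "'a \<Rightarrow> real"
    using assms by (intro sum.group) auto
  have "(\<Sum>i\<le>h. \<Sum>j\<le>h. \<Sum>(u, v)\<in>{v \<in> V. L v = i} \<times> {v \<in> V. L v = j}. g u v)
      = (\<Sum>i\<le>h. \<Sum>j\<le>h. \<Sum>u\<in>{v \<in> V. L v = i}. \<Sum>v\<in>{v \<in> V. L v = j}. g u v)"
    by (simp add: sum.cartesian_product)
  also have "\<dots> = (\<Sum>i\<le>h. \<Sum>u\<in>{v \<in> V. L v = i}. \<Sum>j\<le>h. \<Sum>v\<in>{v \<in> V. L v = j}. g u v)"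
    by (intro sum.cong refl sum.swap)
  finally show ?thesis by (simp add: grp)
qed

lemma sum_pairs_swap:
  fixes g :: "'a \<Rightarrow> 'a \<Rightarrow> real"
  assumes "\<And>u v. u \<in> A \<Longrightarrow> v \<in> B \<Longrightarrow> g u v = g v u"
  shows "(\<Sum>(u, v)\<in>A \<times> B. g u v) = (\<Sum>(u, v)\<in>B \<times> A. g u v)"
proof -
  have "(\<Sum>(u, v)\<in>A \<times> B. g u v) = (\<Sum>(v, u)\<in>B \<times> A. g u v)"
    by (rule sum.reindex_bij_witness[of _ prod.swap prod.swap]) auto
  also have "\<dots> = (\<Sum>(u, v)\<in>B \<times> A. g u v)" using assms by (intro sum.cong) auto
  finally show ?thesis .
qed

context weighted_centred_tree
begin

lemma dist_sum_levels:
  "dist_sum f G = (\<Sum>i\<le>h. \<Sum>j\<le>h. \<Sum>(u, v)\<in>level_pairs (min i j) (max i j). f (d u v))"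
proof -
  have swap: "(\<Sum>(u, v)\<in>level_pairs i j. f (d u v))
      = (\<Sum>(u, v)\<in>level_pairs (min i j) (max i j). f (d u v))" for i j
  proof (cases "i \<le> j")
    case False
    have "(\<Sum>(u, v)\<in>level_pairs i j. f (d u v)) = (\<Sum>(u, v)\<in>level_pairs j i. f (d u v))"
      by (rule sum_pairs_swap, rule arg_cong[of _ _ f], rule dist_sym) (auto simp: level_def)
    then show ?thesis using False by (simp add: min_def max_def)
  qed (simp add: min_def max_def)
  have "dist_sum f G = (\<Sum>i\<le>h. \<Sum>j\<le>h. \<Sum>(u, v)\<in>level_pairs i j. f (d u v))"
    unfolding dist_sum_def level_def
    using pair_finite_verts lev_le by (rule sum_by_levels)
  also have "\<dots> = (\<Sum>i\<le>h. \<Sum>j\<le>h. \<Sum>(u, v)\<in>level_pairs (min i j) (max i j). f (d u v))"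
    by (intro sum.cong refl swap)
  finally show ?thesis .
qed

lemma dist_sum_le_level_bound: "dist_sum f G \<le> level_bound f h \<delta> (\<lambda>i. card (level i))"
  unfolding dist_sum_levels level_bound_def
  by (intro sum_mono level_pair_sum_le) auto

text \<open>
A sum of terms that are bounded one by one reaches the sum of the bounds only if each term reaches its
own.
\<close>

lemma tight_level_pairs:
  assumes tight: "level_bound f h \<delta> (\<lambda>i. card (level i)) \<le> dist_sum f G"
    and ij: "i \<le> j" "j \<le> h"
  shows "(\<Sum>(u, v)\<in>level_pairs i j. f (d u v))
    = level_pair_bound f \<delta> (\<lambda>i. card (level i)) i j"
proof -
  let ?S = "\<lambda>i j. \<Sum>(u, v)\<in>level_pairs (min i j) (max i j). f (d u v)"
  let ?B = "\<lambda>i j. level_pair_bound f \<delta> (\<lambda>i. card (level i)) (min i j) (max i j)"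
  have le: "?S i j \<le> ?B i j" if "i \<le> h" "j \<le> h" for i j
    using that by (intro level_pair_sum_le) auto
  have row: "(\<Sum>j\<le>h. ?S i j) \<le> (\<Sum>j\<le>h. ?B i j)" if "i \<le> h" for i
    using le that by (intro sum_mono) auto
  have "dist_sum f G = level_bound f h \<delta> (\<lambda>i. card (level i))"
    using tight dist_sum_le_level_bound by simp
  then have "(\<Sum>i\<le>h. \<Sum>j\<le>h. ?S i j) = (\<Sum>i\<le>h. \<Sum>j\<le>h. ?B i j)"
    by (simp only: dist_sum_levels level_bound_def)
  then have "(\<Sum>j\<le>h. ?S i j) = (\<Sum>j\<le>h. ?B i j)"
    using sum_mono_inv[of "\<lambda>i. \<Sum>j\<le>h. ?S i j" "{..h}" "\<lambda>i. \<Sum>j\<le>h. ?B i j" i] row ij by auto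
  then have "?S i j = ?B i j"
    using sum_mono_inv[of "?S i" "{..h}" "?B i" j] le ij by auto
  then show ?thesis using ij by (simp add: min_def max_def)
qed

end

section \<open>Double spines\<close>

lemma pcas_consecutive: "pcas u p v \<Longrightarrow> Suc i < length p \<Longrightarrow> fst (p ! Suc i) = snd (p ! i)"
proof (induction p arbitrary: u i)
  case (Cons e p)
  then show ?case by (cases p; cases i) auto
qed simp

lemma pcas_ends: "pcas u p v \<Longrightarrow> p \<noteq> [] \<Longrightarrow> fst (p ! 0) = u \<and> snd (p ! (length p - 1)) = v"
proof (induction p arbitrary: u)
  case (Cons e p)
  then show ?case by (cases "p = []") (auto simp: nth_Cons')
qed simp

lemma pcas_tl_verts: "pcas u p v \<Longrightarrow> tl (pawalk_verts u p) = map snd p"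
proof -
  have "pcas u p v \<Longrightarrow> pawalk_verts u p = u # map snd p"
    by (induction p arbitrary: u) auto
  then show "pcas u p v \<Longrightarrow> tl (pawalk_verts u p) = map snd p" by simp
qed

text \<open>
On a long cycle a vertex of greatest rank would have two distinct neighbours of smaller rank.
\<close>

lemma (in pair_graph) ranked_acyclic:
  fixes \<rho> :: "'a \<Rightarrow> nat"
  assumes neq: "\<And>u v. (u, v) \<in> parcs G \<Longrightarrow> \<rho> u \<noteq> \<rho> v"
    and uniq: "\<And>u v w. (u, v) \<in> parcs G \<Longrightarrow> (u, w) \<in> parcs G \<Longrightarrow> \<rho> v < \<rho> u \<Longrightarrow> \<rho> w < \<rho> u
      \<Longrightarrow> v = w"
    and cyc: "cycle p"
  shows "length p < 3"
proof (rule ccontr)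
  assume long: "\<not> length p < 3"
  obtain u where u: "awalk u p u" "distinct (tl (pawalk_verts u p))"
    using cyc unfolding cycle_def by auto
  define n where "n = length p"
  define w where "w i = snd (p ! i)" for i
  have cas: "pcas u p u" and arcs: "set p \<subseteq> parcs G" using u by auto
  have n: "3 \<le> n" using long by (simp add: n_def)
  have dist: "distinct (map snd p)" using u(2) pcas_tl_verts[OF cas] by simp
  have inj: "i = j" if "w i = w j" "i < n" "j < n" for i j
    using nth_eq_iff_index_eq[OF dist, of i j] that by (simp add: w_def n_def)
  \<comment> \<open>The indices of a closed walk are read modulo its length.\<close>
  have next_arc: "(w i, w ((i + 1) mod n)) \<in> parcs G" if i: "i < n" for i
  proof (cases "Suc i < n")
    case True
    then have "fst (p ! Suc i) = w i" using pcas_consecutive[OF cas] by (simp add: w_def n_def)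
    then have "p ! Suc i = (w i, w (Suc i))" by (simp add: w_def prod_eq_iff)
    moreover have "p ! Suc i \<in> parcs G" using arcs True nth_mem by (auto simp: n_def)
    ultimately show ?thesis using True by simp
  next
    case False
    then have i: "i = n - 1" using i by simp
    have "fst (p ! 0) = w i"
      using pcas_ends[OF cas] n by (cases "p = []") (auto simp: w_def n_def i)
    then have "p ! 0 = (w i, w 0)" by (simp add: w_def prod_eq_iff)
    moreover have "p ! 0 \<in> parcs G"
    proof -
      have "0 < length p" using n unfolding n_def by linarith
      then show ?thesis using arcs nth_mem[of 0 p] by blast
    qed
    moreover have "(i + 1) mod n = 0"
    proof -
      have "i + 1 = n" using i n by linarith
      then show ?thesis by simp
    qed
    ultimately show ?thesis by simp
  qed
  have "finite ((\<lambda>i. \<rho> (w i)) ` {..<n})" "(\<lambda>i. \<rho> (w i)) ` {..<n} \<noteq> {}"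
    using n by (auto simp: lessThan_empty_iff)
  then have "Max ((\<lambda>i. \<rho> (w i)) ` {..<n}) \<in> (\<lambda>i. \<rho> (w i)) ` {..<n}" by (rule Max_in)
  then obtain i where i: "i < n" "\<rho> (w i) = Max ((\<lambda>i. \<rho> (w i)) ` {..<n})" by auto
  have top: "\<rho> (w j) \<le> \<rho> (w i)" if "j < n" for j
    using that unfolding i(2) by (intro Max_ge) auto
  \<comment> \<open>Successor and predecessor of the vertex of greatest rank on the cycle.\<close>
  define j where "j = (i + 1) mod n"
  define k where "k = (i + n - 1) mod n"
  have jk: "j < n" "k < n" using n by (auto simp: j_def k_def)
  have "(k + 1) mod n = i" using i(1) n by (simp add: k_def mod_simps)
  then have arcs: "(w i, w j) \<in> parcs G" "(w i, w k) \<in> parcs G"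
    using next_arc[OF i(1)] next_arc[OF jk(2)] arcs_symmetric by (auto simp: j_def)
  have "w j = w k"
    using uniq[OF arcs] neq[OF arcs(1)] neq[OF arcs(2)] top[OF jk(1)] top[OF jk(2)] by simp
  then have "j = k" using inj jk by blast
  then show False
    using i(1) n by (cases "i = 0"; cases "i = n - 1") (auto simp: j_def k_def mod_if split: if_splits)
qed

context connected_graph
begin

lemma dist_along_arcs:
  assumes "\<And>k. k < m \<Longrightarrow> (s (Suc k), s k) \<in> parcs G" "i \<le> j" "j \<le> m" "s i \<in> pverts G"
  shows "d (s j) (s i) \<le> j - i"
  using assms(2,3)
proof (induction j)
  case 0
  then show ?case using assms(4) by simp
next
  case (Suc j)
  show ?case
  proof (cases "i = Suc j")
    case True
    then show ?thesis using assms(4) by simp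
  next
    case False
    have arc: "(s (Suc j), s j) \<in> parcs G" using assms(1) Suc.prems by simp
    have V: "s j \<in> pverts G" "s (Suc j) \<in> pverts G"
      using arc in_arcsD1 in_arcsD2 by auto
    have "d (s (Suc j)) (s j) = 1" using dist_eq_1_iff[OF V(2,1)] arc by simp
    moreover have "d (s j) (s i) \<le> j - i" using Suc.IH Suc.prems False by simp
    ultimately show ?thesis
      using dist_triangle[OF V(2,1) assms(4)] Suc.prems False by linarith
  qed
qed

text \<open>
Potentials that grow by at most one along every arc give lower bounds for distances.
\<close>

lemma lipschitz_dist:
  fixes g :: "'a \<Rightarrow> int"
  assumes "\<And>u v. (u, v) \<in> parcs G \<Longrightarrow> g v \<le> g u + 1" "u \<in> pverts G" "v \<in> pverts G"
  shows "g v \<le> g u + int (d u v)"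
  using assms(3)
proof (induction "d u v" arbitrary: v)
  case 0
  then have "u = v" using dist_eq_0_iff[OF assms(2)] by metis
  then show ?case by simp
next
  case (Suc n)
  have "u \<noteq> v" using Suc by auto
  then obtain w where w: "w \<in> pverts G" "(w, v) \<in> parcs G" "d u w + 1 = d u v"
    using last_step assms(2) Suc.prems by metis
  have "g w \<le> g u + int (d u w)" using Suc.hyps(1)[of w] Suc.hyps(2) w by simp
  moreover have "g v \<le> g w + 1" using assms(1)[OF w(2)] .
  ultimately show ?case using w(3) by linarith
qed

end

text \<open>
The neighbour of \<open>v\<close> one level below in a double spine, for \<open>v\<close> of positive level. Apart from a vertex
that both spines share, nothing hangs on the spine \<open>b\<close> but its own continuation; all other vertices hang on
the spine \<open>a\<close>.
\<close>

definition spine_parent :: "('a \<Rightarrow> nat) \<Rightarrow> (nat \<Rightarrow> 'a) \<Rightarrow> (nat \<Rightarrow> 'a) \<Rightarrow> 'a \<Rightarrow> 'a" where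
  "spine_parent L a b v = (if v = b (L v) then b (L v - 1) else a (L v - 1))"

text \<open>
The shape of the extremal trees. Two paths \<open>a 0, \<dots>, a h\<close> and \<open>b 0, \<dots>, b h\<close> start in the centre: they
share their first vertex if \<open>\<delta> = 0\<close>, and their first vertices are adjacent if \<open>\<delta> = 1\<close>. Every other
vertex of level \<open>i\<close> is a leaf attached to \<open>a (i - 1)\<close>. In contrast to the concrete caterpillar the vertices
have no names here, so that every tree attaining the bound can be recognised as one.
\<close>

locale double_spine =
  fixes G :: "'a pair_pre_digraph" and L :: "'a \<Rightarrow> nat" and a b :: "nat \<Rightarrow> 'a" and h \<delta> :: nat
  assumes finite_verts: "finite (pverts G)"
    and spine_verts: "\<And>i. i \<le> h \<Longrightarrow> a i \<in> pverts G" "\<And>i. i \<le> h \<Longrightarrow> b i \<in> pverts G"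
    and L_spine: "\<And>i. i \<le> h \<Longrightarrow> L (a i) = i" "\<And>i. i \<le> h \<Longrightarrow> L (b i) = i"
    and L_le: "\<And>v. v \<in> pverts G \<Longrightarrow> L v \<le> h"
    and L_0: "\<And>v. v \<in> pverts G \<Longrightarrow> L v = 0 \<Longrightarrow> v = a 0 \<or> v = b 0"
    and spines_neq: "\<And>i. 1 \<le> i \<Longrightarrow> i \<le> h \<Longrightarrow> a i \<noteq> b i"
    and centres: "a 0 = b 0 \<longleftrightarrow> \<delta> = 0" "\<delta> \<le> 1"
    and height_pos: "1 \<le> h"
    and arcs_iff: "\<And>u v. (u, v) \<in> parcs G \<longleftrightarrow> u \<in> pverts G \<and> v \<in> pverts G \<and>
      (L u = L v + 1 \<and> v = spine_parent L a b u \<or> L v = L u + 1 \<and> u = spine_parent L a b v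
       \<or> \<delta> = 1 \<and> (u = a 0 \<and> v = b 0 \<or> u = b 0 \<and> v = a 0))"
begin

abbreviation "par \<equiv> spine_parent L a b"

definition on_b :: "'a \<Rightarrow> bool" where
  "on_b v \<longleftrightarrow> v = b (L v)"

lemma par_eq: "par v = (if on_b v then b (L v - 1) else a (L v - 1))"
  by (simp add: spine_parent_def on_b_def)

lemma on_b_b: "i \<le> h \<Longrightarrow> on_b (b i)"
  by (simp add: on_b_def L_spine)

lemma on_b_a: "i \<le> h \<Longrightarrow> on_b (a i) \<longleftrightarrow> i = 0 \<and> \<delta> = 0"
  unfolding on_b_def L_spine(1)
  using spines_neq[of i] centres(1) by (cases "i = 0") simp_all

lemma par_props:
  assumes "v \<in> pverts G" "1 \<le> L v"
  shows "par v \<in> pverts G" "L (par v) = L v - 1" "(v, par v) \<in> parcs G" "(par v, v) \<in> parcs G"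
proof -
  have "L v - 1 \<le> h" using L_le[OF assms(1)] by simp
  then show 1: "par v \<in> pverts G" "L (par v) = L v - 1"
    using spine_verts L_spine by (auto simp: par_eq)
  then have "L v = L (par v) + 1" using assms(2) by simp
  then show "(v, par v) \<in> parcs G" "(par v, v) \<in> parcs G" using arcs_iff 1(1) assms(1) by blast+
qed

lemma loopfree: "(u, v) \<in> parcs G \<Longrightarrow> u \<noteq> v"
  using centres(1) unfolding arcs_iff by auto

sublocale pair_graph G
proof -
  have "parcs G \<subseteq> pverts G \<times> pverts G" using arcs_iff by auto
  then have "finite (parcs G)" using finite_verts by (meson finite_SigmaI finite_subset)
  moreover have "sym (parcs G)"
  proof (rule symI)
    fix u v assume "(u, v) \<in> parcs G"
    then show "(v, u) \<in> parcs G" unfolding arcs_iff by blast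
  qed
  moreover have "fst e \<in> pverts G" "snd e \<in> pverts G" "fst e \<noteq> snd e" if "e \<in> parcs G" for e
    using that arcs_iff[of "fst e" "snd e"] loopfree[of "fst e" "snd e"] by simp_all
  ultimately show "pair_graph G"
    using finite_verts by unfold_locales (simp_all add: symmetric_def)
qed

lemma reaches_centre:
  assumes "v \<in> pverts G"
  shows "(v, a 0) \<in> rtrancl_on (pverts G) (parcs G)"
  using assms
proof (induction "L v" arbitrary: v rule: less_induct)
  case less
  show ?case
  proof (cases "L v = 0")
    case True
    have ab: "a 0 \<in> pverts G" "b 0 \<in> pverts G" using spine_verts by auto
    have "(b 0, a 0) \<in> rtrancl_on (pverts G) (parcs G)"
    proof (cases "a 0 = b 0")
      case False
      then have "(b 0, a 0) \<in> parcs G" using centres arcs_iff[of "b 0" "a 0"] ab by auto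
      then show ?thesis
        using rtrancl_on_refl[OF ab(1)] ab(2) by (rule converse_rtrancl_on_into_rtrancl_on)
    qed (use ab in simp)
    then show ?thesis using L_0[OF less.prems True] ab by auto
  next
    case False
    then have p: "par v \<in> pverts G" "L (par v) < L v" "(v, par v) \<in> parcs G"
      using par_props[OF less.prems] by auto
    show ?thesis
      using converse_rtrancl_on_into_rtrancl_on[OF p(3) _ less.prems] less.hyps[OF p(2) p(1)] by blast
  qed
qed

text \<open>
The distance from \<open>a 0\<close>. Unlike \<open>L\<close> it also tells the two centre vertices apart when \<open>\<delta> = 1\<close>.
\<close>

definition rank :: "'a \<Rightarrow> nat" where
  "rank v = (if on_b v then L v + \<delta> else L v)"

lemma rank_par:
  assumes "v \<in> pverts G" "1 \<le> L v"
  shows "rank v = rank (par v) + 1"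
proof -
  have l: "L v - 1 \<le> h" using L_le[OF assms(1)] by simp
  show ?thesis
  proof (cases "on_b v")
    case True
    then have "par v = b (L v - 1)" by (simp add: par_eq)
    then show ?thesis using True on_b_b[OF l] par_props(2)[OF assms] assms(2) by (simp add: rank_def)
  next
    case False
    then have "par v = a (L v - 1)" by (simp add: par_eq)
    then show ?thesis
      using False on_b_a[OF l] par_props(2)[OF assms] assms(2) L_spine(1)[of 0]
      by (auto simp: rank_def)
  qed
qed

lemma rank_centres: "rank (a 0) = 0" "rank (b 0) = \<delta>"
  using on_b_a[of 0] on_b_b[of 0] L_spine[of 0] by (simp_all add: rank_def)

lemma arc_cases:
  assumes "(u, v) \<in> parcs G"
  obtains (down) "rank v < rank u" "1 \<le> L u" "v = par u"
    | (centre_down) "rank v < rank u" "\<delta> = 1" "u = b 0" "v = a 0"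
    | (up) "rank u < rank v" "1 \<le> L v" "u = par v"
    | (centre_up) "rank u < rank v" "\<delta> = 1" "u = a 0" "v = b 0"
proof -
  have V: "u \<in> pverts G" "v \<in> pverts G" using assms in_arcsD1 in_arcsD2 by auto
  consider "L u = L v + 1" "v = par u" | "L v = L u + 1" "u = par v"
    | "\<delta> = 1" "u = a 0" "v = b 0" | "\<delta> = 1" "u = b 0" "v = a 0"
    using assms[unfolded arcs_iff] by blast
  then show ?thesis
  proof cases
    case 1
    then have "1 \<le> L u" by simp
    then show ?thesis using down rank_par[OF V(1)] 1(2) by simp
  next
    case 2
    then have "1 \<le> L v" by simp
    then show ?thesis using up rank_par[OF V(2)] 2(2) by simp
  next
    case 3
    then show ?thesis using centre_up rank_centres by simp
  next
    case 4
    then show ?thesis using centre_down rank_centres by simp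
  qed
qed

lemma L_b_0: "L (b 0) = 0"
  using L_spine(2)[of 0] by simp

lemma unique_lower_neighbour:
  assumes "(u, v) \<in> parcs G" "(u, w) \<in> parcs G" "rank v < rank u" "rank w < rank u"
  shows "v = w"
proof -
  have lower: "(1 \<le> L u \<and> x = par u) \<or> (u = b 0 \<and> x = a 0)"
    if "(u, x) \<in> parcs G" "rank x < rank u" for x
    using that(1) by (cases rule: arc_cases) (use that(2) in auto)
  show ?thesis using lower[OF assms(1,3)] lower[OF assms(2,4)] L_b_0 by auto
qed

sublocale tree_graph G
proof
  have sym: "sym (rtrancl_on (pverts G) (parcs G))"
    by (rule rtrancl_on_sym) (simp add: arcs_symmetric symI)
  have "(u, v) \<in> rtrancl_on (pverts G) (parcs G)" if "u \<in> pverts G" "v \<in> pverts G" for u v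
    using rtrancl_on_trans[OF reaches_centre[OF that(1)] symD[OF sym reaches_centre[OF that(2)]]] .
  then have "(u, v) \<in> rtrancl_on (pverts G) ((parcs G)\<^sup>s)" if "u \<in> pverts G" "v \<in> pverts G" for u v
    using that rtrancl_on_mono[of "parcs G" "(parcs G)\<^sup>s" "pverts G" "pverts G"]
    by (auto simp: symcl_def)
  moreover have "pverts G \<noteq> {}" using spine_verts(1)[of 0] by auto
  ultimately show "Digraph_Component.connected (with_proj G)"
    unfolding connected_conv by simp
  show "length p < 3" if "cycle p" for p
  proof (rule ranked_acyclic[OF _ _ that, of rank])
    show "rank u \<noteq> rank v" if "(u, v) \<in> parcs G" for u v
      using that by (cases rule: arc_cases) auto
  qed (rule unique_lower_neighbour)
qed

lemma dist_par:
  assumes "v \<in> pverts G" "1 \<le> L v"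
  shows "d v (par v) = 1"
  using par_props[OF assms] dist_eq_1_iff[of v "par v"] assms by simp

lemma spine_arcs: "k < h \<Longrightarrow> (a (Suc k), a k) \<in> parcs G" "k < h \<Longrightarrow> (b (Suc k), b k) \<in> parcs G"
  using par_props(3)[of "a (Suc k)"] par_props(3)[of "b (Suc k)"] spine_verts[of "Suc k"]
    L_spine[of "Suc k"] on_b_a[of "Suc k"] on_b_b[of "Suc k"] by (simp_all add: par_eq)

lemma dist_spine:
  assumes "i \<le> j" "j \<le> h"
  shows "d (a j) (a i) \<le> j - i" "d (b j) (b i) \<le> j - i"
  using dist_along_arcs[of h a i j] dist_along_arcs[of h b i j] spine_arcs assms
    spine_verts[of i] by auto

lemma dist_to_a:
  assumes "v \<in> pverts G" "\<not> on_b v" "k < L v"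
  shows "d v (a k) \<le> L v - k"
proof -
  have l: "L v - 1 \<le> h" using L_le[OF assms(1)] by simp
  have "par v = a (L v - 1)" using assms(2) by (simp add: par_eq)
  then have "d v (a (L v - 1)) = 1" using dist_par[OF assms(1)] assms(3) by simp
  moreover have "d (a (L v - 1)) (a k) \<le> L v - 1 - k" using l assms(3) by (intro dist_spine) auto
  moreover have "d v (a k) \<le> d v (a (L v - 1)) + d (a (L v - 1)) (a k)"
    using l assms(1,3) by (intro dist_triangle spine_verts) auto
  ultimately show ?thesis using assms(3) by linarith
qed

lemma dist_to_centre:
  assumes "v \<in> pverts G"
  shows "d v (if on_b v then b 0 else a 0) \<le> L v"
proof (cases "on_b v")
  case True
  then show ?thesis using dist_spine(2)[of 0 "L v"] L_le[OF assms] by (simp add: on_b_def)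
next
  case False
  show ?thesis
  proof (cases "L v = 0")
    case True
    then have "v = a 0" using L_0[OF assms True] False by (auto simp: on_b_def)
    then show ?thesis using False spine_verts(1)[of 0] by simp
  next
    case nz: False
    then show ?thesis using dist_to_a[of v 0] assms False by simp
  qed
qed

lemma dist_centres: "d (a 0) (b 0) \<le> \<delta>"
proof (cases "\<delta> = 0")
  case True
  then show ?thesis using centres(1) spine_verts(2)[of 0] by simp
next
  case False
  then have 1: "\<delta> = 1" using centres(2) by simp
  have V: "a 0 \<in> pverts G" "b 0 \<in> pverts G" using spine_verts by auto
  have "(a 0, b 0) \<in> parcs G" using arcs_iff[of "a 0" "b 0"] V 1 by blast
  then show ?thesis using dist_eq_1_iff[OF V] 1 by simp
qed

text \<open>
The route through the centre.
\<close>

lemma dist_le_L: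
  assumes "u \<in> pverts G" "v \<in> pverts G"
  shows "d u v \<le> L u + L v + \<delta>"
proof -
  let ?c = "\<lambda>v. if on_b v then b 0 else a 0"
  have V: "?c u \<in> pverts G" "?c v \<in> pverts G" using spine_verts[of 0] by auto
  have "a 0 \<in> pverts G" "b 0 \<in> pverts G" using spine_verts by auto
  then have "d (?c u) (?c v) \<le> \<delta>" using dist_centres dist_sym[of "a 0" "b 0"] by simp
  moreover have "d u (?c u) \<le> L u" "d (?c v) v \<le> L v"
    using dist_to_centre[OF assms(1)] dist_to_centre[OF assms(2)] dist_sym[OF V(2) assms(2)]
    by simp_all
  moreover have "d u v \<le> d u (?c u) + d (?c u) v" by (rule dist_triangle[OF assms(1) V(1) assms(2)])
  moreover have "d (?c u) v \<le> d (?c u) (?c v) + d (?c v) v"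
    by (rule dist_triangle[OF V(1) V(2) assms(2)])
  ultimately show ?thesis by linarith
qed

text \<open>
A coordinate in which the two spines form one line, the spine \<open>a\<close> on the negative and the spine \<open>b\<close> on
the positive half. It shows that the ends of the spines are at distance \<open>2 * h + \<delta>\<close> and, more generally,
that routes through the centre are shortest between \<open>b\<close> and the rest.
\<close>

definition position :: "'a \<Rightarrow> int" where
  "position v = (if on_b v then int (L v + \<delta>) else - int (L v))"

lemma position_par:
  assumes "v \<in> pverts G" "1 \<le> L v"
  shows "\<bar>position v - position (par v)\<bar> \<le> 1"
proof -
  have l: "L v - 1 \<le> h" using L_le[OF assms(1)] by simp
  show ?thesis
  proof (cases "on_b v")
    case True
    then have "par v = b (L v - 1)" by (simp add: par_eq)
    then show ?thesis
      using True on_b_b[OF l] par_props(2)[OF assms] assms(2) by (simp add: position_def)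
  next
    case False
    then have "par v = a (L v - 1)" by (simp add: par_eq)
    then show ?thesis
      using False on_b_a[OF l] par_props(2)[OF assms] assms(2) by (auto simp: position_def)
  qed
qed

lemma position_arc:
  assumes "(u, v) \<in> parcs G"
  shows "position v \<le> position u + 1"
proof -
  have V: "u \<in> pverts G" "v \<in> pverts G" using assms in_arcsD1 in_arcsD2 by auto
  have c: "position (a 0) = 0" "position (b 0) = int \<delta>"
    using on_b_a[of 0] on_b_b[of 0] L_spine[of 0] by (auto simp: position_def)
  show ?thesis
    using assms
  proof (cases rule: arc_cases)
    case down
    then show ?thesis using position_par[OF V(1)] by simp
  next
    case up
    then show ?thesis using position_par[OF V(2)] by simp
  qed (use c in simp_all)
qed

lemma eccentricity_L:
  assumes "v \<in> pverts G"
  shows "eccentricity G v = L v + h + \<delta>"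
proof (rule eccentricity_eqI)
  show le: "d v u \<le> L v + h + \<delta>" if "u \<in> pverts G" for u
    using dist_le_L[OF assms that] L_le[OF that] by simp
  \<comment> \<open>A farthest vertex is the end of the other spine.\<close>
  let ?e = "if on_b v then a h else b h"
  show e: "?e \<in> pverts G" using spine_verts by simp
  have pos: "position (a h) = - int h" "position (b h) = int (h + \<delta>)"
    using on_b_a[of h] on_b_b[of h] L_spine[of h] height_pos by (auto simp: position_def)
  have "L v + h + \<delta> \<le> d v ?e"
  proof (cases "on_b v")
    case True
    have "position v \<le> position (a h) + int (d (a h) v)"
      using position_arc spine_verts(1)[of h] assms by (intro lipschitz_dist) auto
    then show ?thesis
      using True pos dist_sym[of v "a h"] spine_verts(1)[of h] assms by (simp add: position_def)
  next
    case False
    have "position (b h) \<le> position v + int (d v (b h))"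
      using position_arc spine_verts(2)[of h] assms by (intro lipschitz_dist) auto
    then show ?thesis using False pos by (simp add: position_def)
  qed
  then show "d v ?e = L v + h + \<delta>" using le[OF e] by simp
qed

definition level :: "nat \<Rightarrow> 'a set" where
  "level i = {v \<in> pverts G. L v = i}"

lemma finite_level [simp]: "finite (level i)"
  using finite_verts by (simp add: level_def)

lemma spine_level: "i \<le> h \<Longrightarrow> a i \<in> level i" "i \<le> h \<Longrightarrow> b i \<in> level i"
  using spine_verts L_spine by (auto simp: level_def)

end

section \<open>Double spines attain the bound\<close>

locale weighted_double_spine = double_spine G L a b h \<delta> + decreasing_weight f
  for G :: "'a pair_pre_digraph" and L a b h \<delta> f
begin

lemma weight_ge:
  assumes "u \<in> pverts G" "v \<in> pverts G" "u \<noteq> v" "d u v \<le> k"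
  shows "f k \<le> f (d u v)"
  using assms dist_eq_0_iff[of u v] by (intro antimono) auto

definition ancestor :: "nat \<Rightarrow> nat \<Rightarrow> 'a \<Rightarrow> 'a" where
  "ancestor i j v = (if v = b j then b i else if i = j then v else a i)"

lemma ancestor_level:
  assumes "i \<le> j" "j \<le> h" "v \<in> level j"
  shows "ancestor i j v \<in> level i"
  using assms spine_level[of i] by (auto simp: ancestor_def)

text \<open>
For \<open>i = j\<close> a vertex is its own ancestor and both sides are \<open>f 0\<close>, which is not the largest value of
\<open>f\<close>; this is why the case is separate.
\<close>

lemma ancestor_weight:
  assumes ij: "i \<le> j" "j \<le> h" and v: "v \<in> level j"
  shows "f (j - i) \<le> f (d (ancestor i j v) v)"
proof (cases "i = j")
  case True
  then have "ancestor i j v = v" by (simp add: ancestor_def)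
  then show ?thesis using True v by (simp add: level_def)
next
  case False
  have V: "v \<in> pverts G" "L v = j" using v by (auto simp: level_def)
  have A: "ancestor i j v \<in> pverts G" "L (ancestor i j v) = i"
    using ancestor_level[OF ij v] by (auto simp: level_def)
  have "d v (ancestor i j v) \<le> j - i"
  proof (cases "v = b j")
    case True
    then show ?thesis using dist_spine(2)[OF ij] by (simp add: ancestor_def)
  next
    case nb: False
    then show ?thesis using dist_to_a[OF V(1), of i] V(2) ij False by (simp add: ancestor_def on_b_def)
  qed
  moreover have "ancestor i j v \<noteq> v" using A(2) V(2) False by auto
  ultimately show ?thesis using weight_ge[OF A(1) V(1)] dist_sym[OF A(1) V(1)] by simp
qed

text \<open>
Both vertices hang below \<open>a (i - 1)\<close>.
\<close>

lemma skew_weight: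
  assumes ij: "i \<le> j" "j \<le> h" "0 < i + \<delta>" and u: "u \<in> level i" "u \<noteq> b i"
    and v: "v \<in> level j" "v \<noteq> b j" and na: "u \<noteq> ancestor i j v"
  shows "f (j - i + 2) \<le> f (d u v)"
proof (rule weight_ge)
  show U: "u \<in> pverts G" and V: "v \<in> pverts G" using u v by (auto simp: level_def)
  have l: "L u = i" "L v = j" using u v by (auto simp: level_def)
  show neq: "u \<noteq> v" using na l v(2) by (auto simp: ancestor_def)
  have "i \<noteq> 0"
  proof
    assume i: "i = 0"
    then have ua: "u = a 0" using L_0[OF U] l(1) u(2) by auto
    show False
    proof (cases "j = 0")
      case True
      then have "v = a 0" using L_0[OF V] l(2) v(2) by auto
      then show False using ua neq by simp
    next
      case False
      then show False using na ua v(2) i by (simp add: ancestor_def)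
    qed
  qed
  then have "i - 1 < i" "i - 1 < j" "i - (i - 1) = 1" "j - (i - 1) = j - i + 1" using ij by auto
  then have "d u (a (i - 1)) \<le> 1" "d v (a (i - 1)) \<le> j - i + 1"
    using dist_to_a[OF U, of "i - 1"] dist_to_a[OF V, of "i - 1"] u(2) v(2)
    unfolding on_b_def l by metis+
  moreover have a: "a (i - 1) \<in> pverts G" using spine_verts(1)[of "i - 1"] ij by simp
  ultimately show "d u v \<le> j - i + 2"
    using dist_triangle[OF U a V] dist_sym[OF a V] by simp
qed

text \<open>
Upper bounds for distances, hence explicit walks, suffice here, because \<open>f\<close> is decreasing.
\<close>

lemma level_pair_sum_ge:
  assumes ij: "i \<le> j" "j \<le> h"
  shows "level_pair_bound f \<delta> (\<lambda>i. card (level i)) i j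
    \<le> (\<Sum>(u, v)\<in>level i \<times> level j. f (d u v))"
proof (cases "i + \<delta> = 0")
  case True
  then have i: "i = 0" "\<delta> = 0" by auto
  have "level 0 = {a 0}"
    using L_0 i(2) centres(1) spine_level(1)[of 0] by (auto simp: level_def)
  then have "(\<Sum>(u, v)\<in>level i \<times> level j. f (d u v)) = (\<Sum>v\<in>level j. f (d (a 0) v))"
    unfolding i(1) by (simp flip: sum.cartesian_product)
  also have "\<dots> \<ge> (\<Sum>v\<in>level j. f j)"
  proof (rule sum_mono)
    fix v assume v: "v \<in> level j"
    then have V: "v \<in> pverts G" "L v = j" by (auto simp: level_def)
    have a: "a 0 \<in> pverts G" "L (a 0) = 0" using spine_verts L_spine by auto
    show "f j \<le> f (d (a 0) v)"
    proof (cases "v = a 0")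
      case True
      then show ?thesis using V a by simp
    next
      case False
      then show ?thesis using weight_ge[OF a(1) V(1)] dist_le_L[OF a(1) V(1)] a V(2) i(2) by simp
    qed
  qed
  finally show ?thesis using True by (simp add: level_pair_bound_def)
next
  case False
  then have pos: "0 < i + \<delta>" by simp
  let ?n = "\<lambda>i. real (card (level i))"
  let ?P = "level i \<times> level j"
  \<comment> \<open>\<open>A\<close> consists of the ancestor pairs and \<open>B\<close> of the pairs with exactly one vertex on the spine \<open>b\<close>.\<close>
  define A where "A = (\<lambda>v. (ancestor i j v, v)) ` level j"
  define B where "B = {b i} \<times> (level j - {b j}) \<union> (level i - {b i}) \<times> {b j}"
  have ih: "i \<le> h" using ij by simp
  have ne: "0 < card (level i)" "0 < card (level j)"
    using spine_level(1)[OF ih] spine_level(1)[OF ij(2)] by (auto simp: card_gt_0_iff)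
  have ab: "a i \<noteq> b i" using spines_neq[of i] centres(1) pos ih by (cases "i = 0") auto
  have sub: "A \<subseteq> ?P" "B \<subseteq> ?P"
    using ancestor_level[OF ij] spine_level(2)[OF ih] spine_level(2)[OF ij(2)]
    by (auto simp: A_def B_def)
  have disj: "A \<inter> B = {}"
    using ab by (auto simp: A_def B_def ancestor_def split: if_splits)
  have cA: "real (card A) = ?n j"
    unfolding A_def by (subst card_image) (auto simp: inj_on_def)
  have cB: "real (card B) = ?n i + ?n j - 2"
  proof -
    have "card B = card ({b i} \<times> (level j - {b j})) + card ((level i - {b i}) \<times> {b j})"
      unfolding B_def by (intro card_Un_disjoint) auto
    also have "\<dots> = (card (level j) - 1) + (card (level i) - 1)"
      using spine_level(2)[OF ih] spine_level(2)[OF ij(2)] by (simp add: card_cartesian_product)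
    finally show ?thesis using ne by simp
  qed
  have cP: "?n i * ?n j = real (card A) + real (card B) + real (card (?P - A - B))"
    using sum_three_parts[OF _ sub disj, of "\<lambda>_. 1 :: real"] by (simp add: card_cartesian_product)
  have "card A * f (j - i) \<le> (\<Sum>(u, v)\<in>A. f (d u v))"
    using ancestor_weight[OF ij] by (intro sum_bounded_below) (auto simp: A_def)
  moreover have "card B * f (i + j + \<delta>) \<le> (\<Sum>(u, v)\<in>B. f (d u v))"
  proof (rule sum_bounded_below)
    fix p assume p: "p \<in> B"
    obtain u v where uv: "p = (u, v)" by (cases p)
    have "u \<in> level i" "v \<in> level j" using p sub(2) uv by auto
    then have V: "u \<in> pverts G" "v \<in> pverts G" "L u = i" "L v = j" by (auto simp: level_def)
    have "u \<noteq> v" using p V(3,4) unfolding uv B_def by auto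
    then show "f (i + j + \<delta>) \<le> (case p of (u, v) \<Rightarrow> f (d u v))"
      using weight_ge[OF V(1,2)] dist_le_L[OF V(1,2)] V(3,4) uv by simp
  qed
  moreover have "card (?P - A - B) * f (j - i + 2) \<le> (\<Sum>(u, v)\<in>?P - A - B. f (d u v))"
  proof (rule sum_bounded_below)
    fix p assume p: "p \<in> ?P - A - B"
    obtain u v where uv: "p = (u, v)" by (cases p)
    have l: "u \<in> level i" "v \<in> level j" using p uv by auto
    have na: "u \<noteq> ancestor i j v" using p l by (auto simp: uv A_def)
    have "u \<noteq> b i \<and> v \<noteq> b j"
    proof (cases "v = b j")
      case True
      then show ?thesis using p na l by (auto simp: uv B_def ancestor_def)
    next
      case False
      then show ?thesis using p l by (auto simp: uv B_def)
    qed
    then show "f (j - i + 2) \<le> (case p of (u, v) \<Rightarrow> f (d u v))"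
      using skew_weight[OF ij pos l(1) _ l(2) _ na] uv by simp
  qed
  moreover have "level_pair_bound f \<delta> (\<lambda>i. card (level i)) i j
    = card A * f (j - i) + card B * f (i + j + \<delta>) + card (?P - A - B) * f (j - i + 2)"
  proof -
    have "real (card (?P - A - B)) = (?n i - 2) * (?n j - 1)"
      using cP unfolding cA cB by (simp add: algebra_simps)
    then show ?thesis unfolding level_pair_bound_def if_not_P[OF False] cA cB by simp
  qed
  moreover have "(\<Sum>(u, v)\<in>?P. f (d u v)) = (\<Sum>(u, v)\<in>A. f (d u v)) + (\<Sum>(u, v)\<in>B. f (d u v))
      + (\<Sum>(u, v)\<in>?P - A - B. f (d u v))"
    by (rule sum_three_parts[OF _ sub disj]) simp
  ultimately show ?thesis by linarith
qed

lemma level_bound_le_dist_sum: "level_bound f h \<delta> (\<lambda>i. card (level i)) \<le> dist_sum f G"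
proof -
  have "level_pair_bound f \<delta> (\<lambda>i. card (level i)) (min i j) (max i j)
      \<le> (\<Sum>(u, v)\<in>level i \<times> level j. f (d u v))" if "i \<le> h" "j \<le> h" for i j
  proof (cases "i \<le> j")
    case True
    then show ?thesis using level_pair_sum_ge[of i j] that by (simp add: min_def max_def)
  next
    case False
    have "(\<Sum>(u, v)\<in>level i \<times> level j. f (d u v)) = (\<Sum>(u, v)\<in>level j \<times> level i. f (d u v))"
      by (rule sum_pairs_swap, rule arg_cong[of _ _ f], rule dist_sym) (auto simp: level_def)
    then show ?thesis using level_pair_sum_ge[of j i] that False by (simp add: min_def max_def)
  qed
  then have "level_bound f h \<delta> (\<lambda>i. card (level i))
      \<le> (\<Sum>i\<le>h. \<Sum>j\<le>h. \<Sum>(u, v)\<in>level i \<times> level j. f (d u v))"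
    unfolding level_bound_def by (intro sum_mono) auto
  also have "\<dots> = dist_sum f G"
    unfolding dist_sum_def level_def
    using finite_verts L_le by (rule sum_by_levels[symmetric])
  finally show ?thesis .
qed

end

section \<open>Isomorphisms\<close>

lemma graph_isoI:
  assumes "pair_wf_digraph G" "pair_wf_digraph H" and bij: "bij_betw \<phi> (pverts G) (pverts H)"
    and arcs: "\<And>u v. u \<in> pverts G \<Longrightarrow> v \<in> pverts G \<Longrightarrow>
      (u, v) \<in> parcs G \<longleftrightarrow> (\<phi> u, \<phi> v) \<in> parcs H"
  shows "graph_iso G H"
proof -
  interpret G: pair_wf_digraph G by fact
  interpret H: pair_wf_digraph H by fact
  define hom where "hom = \<lparr> iso_verts = \<phi>, iso_arcs = map_prod \<phi> \<phi>,
    iso_head = (snd :: 'b \<times> 'b \<Rightarrow> 'b), iso_tail = (fst :: 'b \<times> 'b \<Rightarrow> 'b) \<rparr>"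
  have inj: "inj_on \<phi> (pverts G)" and im: "\<phi> ` pverts G = pverts H"
    using bij by (auto simp: bij_betw_def)
  have "parcs G \<subseteq> pverts G \<times> pverts G" using G.in_arcsD1 G.in_arcsD2 by auto
  moreover have "inj_on (map_prod \<phi> \<phi>) (pverts G \<times> pverts G)"
    using inj by (rule map_prod_inj_on[OF inj])
  ultimately have "inj_on (map_prod \<phi> \<phi>) (parcs G)" by (meson inj_on_subset)
  moreover have "wf_digraph (with_proj G)" by unfold_locales
  ultimately have "pre_digraph.digraph_isomorphism (with_proj G) hom"
    using inj unfolding pre_digraph.digraph_isomorphism_def by (simp add: hom_def)
  moreover have "map_prod \<phi> \<phi> ` parcs G = parcs H"
  proof
    show "map_prod \<phi> \<phi> ` parcs G \<subseteq> parcs H"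
    proof
      fix e assume "e \<in> map_prod \<phi> \<phi> ` parcs G"
      then obtain u v where uv: "(u, v) \<in> parcs G" "e = (\<phi> u, \<phi> v)" by force
      then show "e \<in> parcs H" using arcs[OF G.in_arcsD1[OF uv(1)] G.in_arcsD2[OF uv(1)]] by simp
    qed
    show "parcs H \<subseteq> map_prod \<phi> \<phi> ` parcs G"
    proof
      fix e assume e: "e \<in> parcs H"
      then obtain x y where xy: "e = (x, y)" "x \<in> pverts H" "y \<in> pverts H"
        using H.in_arcsD1 H.in_arcsD2 by (metis prod.collapse)
      then obtain u v where uv: "u \<in> pverts G" "v \<in> pverts G" "x = \<phi> u" "y = \<phi> v"
        using im by blast
      then have "(u, v) \<in> parcs G" using arcs e xy by simp
      then show "e \<in> map_prod \<phi> \<phi> ` parcs G" using xy uv by force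
    qed
  qed
  then have "with_proj H = app_iso hom (with_proj G)"
    using im by (simp add: app_iso_def hom_def with_proj_def)
  ultimately show ?thesis unfolding graph_iso_def digraph_iso_def by blast
qed

lemma graph_iso_dist_sum:
  assumes "graph_iso G H" "pair_wf_digraph G"
  shows "dist_sum f G = dist_sum f H"
proof -
  interpret pair_wf_digraph G by fact
  obtain hom where hom: "digraph_isomorphism hom" and H: "with_proj H = app_iso hom (with_proj G)"
    using assms(1) by (auto simp: graph_iso_def digraph_iso_def)
  let ?\<phi> = "iso_verts hom"
  have im: "pverts H = ?\<phi> ` pverts G"
    using arg_cong[OF H, of verts] by simp
  have inj: "inj_on ?\<phi> (pverts G)" using digraph_isomorphism_inj_on_verts[OF hom] by simp
  have dist: "gdist H (?\<phi> u) (?\<phi> v) = gdist G u v" if uv: "u \<in> pverts G" "v \<in> pverts G" for u v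
  proof -
    have "(\<exists>p. pre_digraph.awalk (with_proj H) (?\<phi> u) p (?\<phi> v) \<and> length p = n)
        \<longleftrightarrow> (\<exists>p. awalk u p v \<and> length p = n)" for n
    proof
      assume "\<exists>p. pre_digraph.awalk (with_proj H) (?\<phi> u) p (?\<phi> v) \<and> length p = n"
      then obtain p where "pre_digraph.awalk (app_iso hom (with_proj G)) (?\<phi> u) p (?\<phi> v)" "length p = n"
        unfolding H by blast
      then show "\<exists>p. awalk u p v \<and> length p = n"
        using awalk_app_isoD[OF _ hom, of "?\<phi> u" p "?\<phi> v"] iso_verts_inv_iso[OF hom] uv
        by (metis length_map with_proj_simps(1))
    next
      assume "\<exists>p. awalk u p v \<and> length p = n"
      then show "\<exists>p. pre_digraph.awalk (with_proj H) (?\<phi> u) p (?\<phi> v) \<and> length p = n"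
        unfolding H using awalk_app_isoI[OF _ hom, of u _ v] by (metis length_map)
    qed
    then show ?thesis unfolding gdist_def by simp
  qed
  have "dist_sum f H = (\<Sum>u\<in>pverts G. \<Sum>v\<in>pverts G. f (gdist H (?\<phi> u) (?\<phi> v)))"
    unfolding dist_sum_def im by (simp add: sum.reindex[OF inj])
  also have "\<dots> = dist_sum f G"
    unfolding dist_sum_def using dist by (intro sum.cong) auto
  finally show ?thesis by simp
qed

text \<open>
Adjacency in a double spine depends only on the levels and on which vertices form the spines. Hence
any bijections between corresponding levels that respect the spines combine to an isomorphism.
\<close>

lemma double_spine_iso:
  assumes "double_spine G L a b h \<delta>" "double_spine G' L' a' b' h \<delta>"
    and cards: "\<And>i. i \<le> h \<Longrightarrow> card {v \<in> pverts G. L v = i} = card {v \<in> pverts G'. L' v = i}"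
  shows "graph_iso G G'"
proof -
  interpret S: double_spine G L a b h \<delta> by fact
  interpret T: double_spine G' L' a' b' h \<delta> by fact
  have ab: "a i = b i \<longleftrightarrow> a' i = b' i" if "i \<le> h" for i
    using S.spines_neq[of i] T.spines_neq[of i] S.centres(1) T.centres(1) that by (cases "i = 0") auto
  have "\<exists>\<phi>. bij_betw \<phi> (S.level i) (T.level i) \<and> \<phi> (a i) = a' i \<and> \<phi> (b i) = b' i" if i: "i \<le> h" for i
  proof -
    let ?A = "S.level i - {a i, b i}" and ?B = "T.level i - {a' i, b' i}"
    have "card {a i, b i} = card {a' i, b' i}" using ab[OF i] by (simp add: card_insert_if)
    then have "card ?A = card ?B"
      using cards[OF i] S.spine_level[OF i] T.spine_level[OF i]
      by (simp add: card_Diff_subset flip: S.level_def T.level_def)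
    then obtain \<psi> where psi: "bij_betw \<psi> ?A ?B"
      using finite_same_card_bij[of ?A ?B] by auto
    \<comment> \<open>The two spine vertices of a level are matched first, the rest arbitrarily.\<close>
    define \<phi> where "\<phi> v = (if v = a i then a' i else if v = b i then b' i else \<psi> v)" for v
    have eqs: "\<phi> (a i) = a' i" "\<phi> (b i) = b' i" using ab[OF i] by (auto simp: \<phi>_def)
    have "bij_betw \<phi> ?A ?B"
      using psi by (rule bij_betw_cong[THEN iffD1, rotated]) (auto simp: \<phi>_def)
    moreover have "bij_betw \<phi> {a i, b i} {a' i, b' i}"
      using eqs ab[OF i] unfolding bij_betw_def inj_on_def by (cases "a i = b i") simp_all
    ultimately have "bij_betw \<phi> (?A \<union> {a i, b i}) (?B \<union> {a' i, b' i})"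
      by (rule bij_betw_combine) auto
    moreover have "?A \<union> {a i, b i} = S.level i" "?B \<union> {a' i, b' i} = T.level i"
      using S.spine_level[OF i] T.spine_level[OF i] by auto
    ultimately show ?thesis using eqs by auto
  qed
  then obtain \<Phi> where Phi: "\<And>i. i \<le> h \<Longrightarrow> bij_betw (\<Phi> i) (S.level i) (T.level i)"
    "\<And>i. i \<le> h \<Longrightarrow> \<Phi> i (a i) = a' i" "\<And>i. i \<le> h \<Longrightarrow> \<Phi> i (b i) = b' i"
    by metis
  define \<phi> where "\<phi> v = \<Phi> (L v) v" for v
  have lev: "\<phi> v \<in> pverts G' \<and> L' (\<phi> v) = L v" if v: "v \<in> pverts G" for v
    using bij_betwE[OF Phi(1)[OF S.L_le[OF v]]] v
    by (auto simp: \<phi>_def S.level_def T.level_def)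
  have inj: "inj_on \<phi> (pverts G)"
  proof (rule inj_onI)
    fix u v assume uv: "u \<in> pverts G" "v \<in> pverts G" "\<phi> u = \<phi> v"
    then have L: "L u = L v" using lev by metis
    have "inj_on (\<Phi> (L v)) (S.level (L v))" using Phi(1)[OF S.L_le[OF uv(2)]] by (simp add: bij_betw_def)
    then show "u = v" using uv L by (auto simp: \<phi>_def S.level_def dest: inj_onD)
  qed
  have "\<phi> ` pverts G = pverts G'"
  proof
    show "\<phi> ` pverts G \<subseteq> pverts G'" using lev by auto
    show "pverts G' \<subseteq> \<phi> ` pverts G"
    proof
      fix w assume w: "w \<in> pverts G'"
      then have "w \<in> T.level (L' w)" by (simp add: T.level_def)
      then have "w \<in> \<Phi> (L' w) ` S.level (L' w)"
        using Phi(1)[OF T.L_le[OF w]] by (simp add: bij_betw_def)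
      then obtain v where "v \<in> pverts G" "L v = L' w" "w = \<Phi> (L' w) v" by (auto simp: S.level_def)
      then have "v \<in> pverts G" "w = \<phi> v" by (simp_all add: \<phi>_def)
      then show "w \<in> \<phi> ` pverts G" by blast
    qed
  qed
  with inj have bij: "bij_betw \<phi> (pverts G) (pverts G')" by (simp add: bij_betw_def)
  have spine: "\<phi> (a i) = a' i" "\<phi> (b i) = b' i" if "i \<le> h" for i
    using Phi(2,3)[OF that] S.L_spine[OF that] by (simp_all add: \<phi>_def)
  have eq_iff: "\<phi> u = \<phi> v \<longleftrightarrow> u = v" if "u \<in> pverts G" "v \<in> pverts G" for u v
    using inj that by (auto dest: inj_onD)
  have on_b: "T.on_b (\<phi> v) \<longleftrightarrow> S.on_b v" if v: "v \<in> pverts G" for v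
  proof -
    have l: "L v \<le> h" using S.L_le[OF v] .
    have "T.on_b (\<phi> v) \<longleftrightarrow> \<phi> v = \<phi> (b (L v))" using lev[OF v] spine(2)[OF l] by (simp add: T.on_b_def)
    then show ?thesis using eq_iff[OF v S.spine_verts(2)[OF l]] by (simp add: S.on_b_def)
  qed
  \<comment> \<open>The parent is computed from the level and from membership in the spine \<open>b\<close>, both of which
    are preserved.\<close>
  have par: "T.par (\<phi> v) = \<phi> (S.par v)" if v: "v \<in> pverts G" for v
  proof -
    have "L v - 1 \<le> h" using S.L_le[OF v] by simp
    then show ?thesis
      unfolding T.par_eq S.par_eq on_b[OF v] using lev[OF v] spine by simp
  qed
  show ?thesis
  proof (rule graph_isoI[OF _ _ bij])
    show "pair_wf_digraph G" "pair_wf_digraph G'" by unfold_locales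
    fix u v assume uv: "u \<in> pverts G" "v \<in> pverts G"
    have 0: "a 0 \<in> pverts G" "b 0 \<in> pverts G" "a' 0 = \<phi> (a 0)" "b' 0 = \<phi> (b 0)"
      using S.spine_verts[of 0] spine[of 0] by simp_all
    have p: "\<phi> v = T.par (\<phi> u) \<longleftrightarrow> v = S.par u" if "L u = L v + 1" "u \<in> pverts G" "v \<in> pverts G" for u v
    proof -
      have "S.par u \<in> pverts G" using S.par_props(1)[OF that(2)] that(1) by simp
      then show ?thesis unfolding par[OF that(2)] using eq_iff that by blast
    qed
    show "(u, v) \<in> parcs G \<longleftrightarrow> (\<phi> u, \<phi> v) \<in> parcs G'"
      unfolding S.arcs_iff T.arcs_iff 0(3,4) eq_iff[OF uv(1) 0(1)] eq_iff[OF uv(1) 0(2)]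
        eq_iff[OF uv(2) 0(1)] eq_iff[OF uv(2) 0(2)]
      using uv lev[OF uv(1)] lev[OF uv(2)] p[of u v] p[of v u] by metis
  qed
qed

section \<open>Trees attaining the bound are double spines\<close>

context centred_tree
begin

lemma lev_diff_le_dist:
  assumes "u \<in> pverts G" "v \<in> pverts G"
  shows "lev v - lev u \<le> d u v"
proof (cases "far u = far v")
  case True
  have "d c v \<le> d c u + d u v" using dist_triangle assms by simp
  then show ?thesis
    using True dist_c_lev(1)[OF assms(1)] dist_c_lev(1)[OF assms(2)] by (auto split: if_splits)
next
  case False
  then show ?thesis using dist_cross'[OF assms False] by simp
qed

lemma ancestor_exists_any:
  assumes v: "v \<in> pverts G" and i: "i \<le> lev v"
  shows "\<exists>u\<in>pverts G. lev u = i \<and> d u v = lev v - i \<and> (0 < i + \<delta> \<longrightarrow> far u = far v)"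
proof (cases "0 < i + \<delta>")
  case True
  then show ?thesis using ancestor_exists[OF v i] by metis
next
  case False
  then have i: "i = 0" and dc: "d c v = lev v" using dist_c_lev(1)[OF v] by simp_all
  show ?thesis
  proof (intro bexI[of _ c] conjI impI)
    show "lev c = i" by (simp only: lev_ends i)
    show "d c v = lev v - i" by (simp only: dc i diff_zero)
  qed (use False in simp_all)
qed

lemma lower_neighbour_exists:
  assumes v: "v \<in> pverts G" and "1 \<le> lev v"
  shows "\<exists>u. (u, v) \<in> parcs G \<and> lev u + 1 = lev v"
proof -
  obtain u where u: "u \<in> pverts G" "lev u = lev v - 1" "d u v = lev v - (lev v - 1)"
    using ancestor_exists_any[OF v, of "lev v - 1"] by auto
  then have "d u v = 1" using assms(2) by simp
  then show ?thesis using dist_eq_1_iff[OF u(1) v] u(2) assms(2) by auto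
qed

lemma lower_neighbour_unique:
  assumes "(u, v) \<in> parcs G" "lev u + 1 = lev v" "(u', v) \<in> parcs G" "lev u' + 1 = lev v"
  shows "u = u'"
proof -
  have V: "u \<in> pverts G" "u' \<in> pverts G" "v \<in> pverts G" using assms in_arcsD1 in_arcsD2 by auto
  have "d u v = 1" "d u' v = 1" using V assms dist_eq_1_iff by simp_all
  moreover have "lev v - lev u = 1" "lev v - lev u' = 1" "lev u = lev u'" "lev u \<le> lev v"
    using assms(2,4) by linarith+
  ultimately show ?thesis by (intro ancestor_unique[OF V(3) V(1) _ V(2)]) simp_all
qed

text \<open>
The ancestors of \<open>s\<close>, indexed by their level.
\<close>

lemma geodesic_to_centre:
  assumes s: "s \<in> pverts G" "lev s = h"
  obtains A where "\<And>i. i \<le> h \<Longrightarrow> A i \<in> pverts G" "\<And>i. i \<le> h \<Longrightarrow> lev (A i) = i"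
    "\<And>i. i \<le> h \<Longrightarrow> 0 < i + \<delta> \<Longrightarrow> far (A i) = far s" "\<And>i. i < h \<Longrightarrow> (A i, A (Suc i)) \<in> parcs G"
proof -
  have "\<forall>i. \<exists>u. i \<le> h \<longrightarrow> u \<in> pverts G \<and> lev u = i \<and> d u s = h - i \<and> (0 < i + \<delta> \<longrightarrow> far u = far s)"
  proof
    fix i show "\<exists>u. i \<le> h \<longrightarrow> u \<in> pverts G \<and> lev u = i \<and> d u s = h - i \<and> (0 < i + \<delta> \<longrightarrow> far u = far s)"
    proof (cases "i \<le> h")
      case True
      then have il: "i \<le> lev s" using s(2) by simp
      obtain u where "u \<in> pverts G" "lev u = i" "d u s = lev s - i" "0 < i + \<delta> \<longrightarrow> far u = far s"
        using ancestor_exists_any[OF s(1) il] by (elim bexE conjE) (rule that)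
      then show ?thesis using s(2) by (intro exI[of _ u]) simp
    qed simp
  qed
  then obtain A where A: "\<And>i. i \<le> h \<Longrightarrow> A i \<in> pverts G" "\<And>i. i \<le> h \<Longrightarrow> lev (A i) = i"
    "\<And>i. i \<le> h \<Longrightarrow> d (A i) s = h - i" "\<And>i. i \<le> h \<Longrightarrow> 0 < i + \<delta> \<Longrightarrow> far (A i) = far s"
    by metis
  have "(A i, A (Suc i)) \<in> parcs G" if i: "i < h" for i
  proof -
    have V: "A i \<in> pverts G" "A (Suc i) \<in> pverts G" using A(1) i by simp_all
    have l: "lev (A i) = i" "lev (A (Suc i)) = Suc i" using A(2) i by simp_all
    obtain w where w: "(w, A (Suc i)) \<in> parcs G" "lev w + 1 = lev (A (Suc i))"
      using lower_neighbour_exists[OF V(2)] l by auto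
    have wV: "w \<in> pverts G" and wl: "lev w = i" using w in_arcsD1 l by auto
    have "d w (A (Suc i)) = 1" using dist_eq_1_iff[OF wV V(2)] w(1) by simp
    then have "d w s \<le> 1 + d (A (Suc i)) s" using dist_triangle[OF wV V(2) s(1)] by simp
    then have "d w s \<le> h - i" using A(3)[of "Suc i"] i by simp
    moreover have "h - i \<le> d w s" using lev_diff_le_dist[OF wV s(1)] wl s(2) by simp
    ultimately have "d w s = h - i" by simp
    then have "w = A i"
      using A(3)[of i] i wl l(1) s(2) by (intro ancestor_unique[OF s(1) wV _ V(1)]) simp_all
    then show ?thesis using w(1) by simp
  qed
  then show ?thesis using that[of A] A by blast
qed

text \<open>
The middle vertex between \<open>u\<close> and \<open>v\<close> cannot lie above them, since it would then have two lower
neighbours.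
\<close>

lemma siblings_share_parent:
  assumes uv: "u \<in> pverts G" "v \<in> pverts G" "lev u = lev v" "1 \<le> lev u" "d u v = 2"
    and p: "(p, u) \<in> parcs G" "lev p + 1 = lev u"
  shows "(p, v) \<in> parcs G"
proof -
  obtain w where w: "w \<in> pverts G" "d u w = 1" "d w v = 1"
    using geodesic_point[OF uv(1,2), of 1] uv(5) by auto
  have arcs: "(u, w) \<in> parcs G" "(w, v) \<in> parcs G"
    using w dist_eq_1_iff uv(1,2) by simp_all
  then have arcs': "(w, u) \<in> parcs G" "(v, w) \<in> parcs G" using arcs_symmetric by simp_all
  have "lev w = lev u + 1 \<or> lev u = lev w + 1"
    using arc_lev_cases[OF arcs(1)] lev_eq_0_iff[OF uv(1)] uv(4) by (metis not_one_le_zero)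
  then show ?thesis
  proof
    assume "lev w = lev u + 1"
    then have "u = v" using lower_neighbour_unique[OF arcs(1) _ arcs'(2)] uv(3) by simp
    then show ?thesis using uv by simp
  next
    assume "lev u = lev w + 1"
    then have "w = p" using lower_neighbour_unique[OF arcs'(1) _ p] by simp
    then show ?thesis using arcs(2) by simp
  qed
qed

text \<open>
The side \<open>\<beta>\<close> is a path and provides the spine \<open>b\<close>. On the other side the vertices of a level are pairwise
at distance \<open>2\<close>, so they share their parent, which is therefore the parent of the vertex of the spine \<open>a\<close>
on that level. The hypothesis \<open>2 < 2 * i + \<delta>\<close> leaves out level \<open>1\<close> for \<open>\<delta> = 0\<close>, where the parent is the
single centre vertex in any case.
\<close>

lemma double_spine_if_thin_side:
  assumes thin: "\<And>i u v. \<lbrakk>i \<le> h; 2 < 2 * i + \<delta>; u \<in> level i; v \<in> level i; far u = \<beta>; far v = \<beta>\<rbrakk>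
      \<Longrightarrow> u = v"
    and sib: "\<And>i u v. \<lbrakk>i \<le> h; 2 < 2 * i + \<delta>; u \<in> level i; v \<in> level i; far u = far v; u \<noteq> v\<rbrakk>
      \<Longrightarrow> d u v = 2"
  obtains a b where "double_spine G lev a b h \<delta>"
proof -
  \<comment> \<open>\<open>s\<close> and \<open>t\<close> are the ends of the longest path on the thick and on the thin side.\<close>
  define s where "s = (if \<beta> then x else y)"
  define t where "t = (if \<beta> then y else x)"
  have st: "s \<in> pverts G" "t \<in> pverts G" "lev s = h" "lev t = h" "far s \<noteq> \<beta>" "far t = \<beta>"
    using ends near_x far_y by (auto simp: s_def t_def)
  obtain a where a: "\<And>i. i \<le> h \<Longrightarrow> a i \<in> pverts G" "\<And>i. i \<le> h \<Longrightarrow> lev (a i) = i"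
    "\<And>i. i \<le> h \<Longrightarrow> 0 < i + \<delta> \<Longrightarrow> far (a i) = far s" "\<And>i. i < h \<Longrightarrow> (a i, a (Suc i)) \<in> parcs G"
    using geodesic_to_centre[OF st(1,3)] by blast
  obtain b where b: "\<And>i. i \<le> h \<Longrightarrow> b i \<in> pverts G" "\<And>i. i \<le> h \<Longrightarrow> lev (b i) = i"
    "\<And>i. i \<le> h \<Longrightarrow> 0 < i + \<delta> \<Longrightarrow> far (b i) = far t" "\<And>i. i < h \<Longrightarrow> (b i, b (Suc i)) \<in> parcs G"
    using geodesic_to_centre[OF st(2,4)] by blast
  have neq: "a i \<noteq> b i" if "i \<le> h" "0 < i + \<delta>" for i
    using a(3)[OF that] b(3)[OF that] st by auto
  have centre: "v = c \<or> \<delta> = 1 \<and> v = q" if "v \<in> pverts G" "lev v = 0" for v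
    using lev_eq_0_iff that by simp
  have ab0: "a 0 \<in> pverts G" "b 0 \<in> pverts G" "lev (a 0) = 0" "lev (b 0) = 0"
    using a b by simp_all
  have c0: "(\<delta> = 0 \<and> a 0 = c \<and> b 0 = c) \<or> (\<delta> = 1 \<and> (a 0 = c \<and> b 0 = q \<or> a 0 = q \<and> b 0 = c))"
  proof (cases "\<delta> = 0")
    case True
    then show ?thesis using centre ab0 by force
  next
    case False
    then have "\<delta> = 1" "a 0 \<noteq> b 0" using parity_le neq[of 0] by auto
    then show ?thesis using centre ab0 by blast
  qed
  have parent: "(spine_parent lev a b v, v) \<in> parcs G \<and> lev (spine_parent lev a b v) + 1 = lev v"
    if v: "v \<in> pverts G" "1 \<le> lev v" for v
  proof -
    define i where "i = lev v - 1"
    have i: "lev v = Suc i" "i < h" using v(2) lev_le[OF v(1)] by (auto simp: i_def)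
    have parent_eq: "spine_parent lev a b v = (if v = b (Suc i) then b i else a i)"
      unfolding spine_parent_def i(1) by simp
    show ?thesis
    proof (cases "v = b (Suc i)")
      case True
      then show ?thesis using b(4)[OF i(2)] b(2)[of i] i parent_eq by simp
    next
      case False
      have "(a i, v) \<in> parcs G"
      proof (cases "2 < 2 * Suc i + \<delta>")
        case True
        have h: "Suc i \<le> h" using i by simp
        have lv: "v \<in> level (Suc i)" "a (Suc i) \<in> level (Suc i)" "b (Suc i) \<in> level (Suc i)"
          using v(1) i a(1,2)[OF h] b(1,2)[OF h] by (simp_all add: level_def)
        have "far v \<noteq> \<beta>" using thin[OF h True lv(1,3)] False b(3)[OF h] st(6) by auto
        then have side: "far (a (Suc i)) = far v" using a(3)[OF h] st(5) by auto
        show ?thesis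
        proof (cases "v = a (Suc i)")
          case True
          then show ?thesis using a(4)[OF i(2)] by simp
        next
          case nv: False
          have "d (a (Suc i)) v = 2" using sib[OF h True lv(2,1) side] nv by blast
          then show ?thesis
            using siblings_share_parent[of "a (Suc i)" v "a i"] a(1,2)[OF h] a(2)[of i] a(4)[OF i(2)] v(1) i by simp
        qed
      next
        case False
        then have "i = 0" "\<delta> = 0" by auto
        obtain w where w: "(w, v) \<in> parcs G" "lev w + 1 = lev v"
          using lower_neighbour_exists[OF v] by blast
        then have "w = c" using centre[of w] in_arcsD1[OF w(1)] i(1) \<open>i = 0\<close> \<open>\<delta> = 0\<close> by simp
        then show ?thesis using w(1) c0 \<open>i = 0\<close> \<open>\<delta> = 0\<close> by simp
      qed
      then show ?thesis using False a(2)[of i] i parent_eq by simp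
    qed
  qed
  have "double_spine G lev a b h \<delta>"
  proof
    show "finite (pverts G)" by (rule pair_finite_verts)
    show "v = a 0 \<or> v = b 0" if "v \<in> pverts G" "lev v = 0" for v
      using centre[OF that] c0 by auto
    show "a 0 = b 0 \<longleftrightarrow> \<delta> = 0"
      using c0 neq[of 0] by auto
    show "(u, v) \<in> parcs G \<longleftrightarrow> u \<in> pverts G \<and> v \<in> pverts G \<and>
      (lev u = lev v + 1 \<and> v = spine_parent lev a b u \<or> lev v = lev u + 1 \<and> u = spine_parent lev a b v
       \<or> \<delta> = 1 \<and> (u = a 0 \<and> v = b 0 \<or> u = b 0 \<and> v = a 0))" for u v
    proof
      assume uv: "(u, v) \<in> parcs G"
      have V: "u \<in> pverts G" "v \<in> pverts G" using uv in_arcsD1 in_arcsD2 by auto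
      have vu: "(v, u) \<in> parcs G" using uv arcs_symmetric by simp
      consider "lev u = lev v + 1" | "lev v = lev u + 1" | "\<delta> = 1" "u = c \<and> v = q \<or> u = q \<and> v = c"
        using arc_lev_cases[OF uv] by blast
      then show "u \<in> pverts G \<and> v \<in> pverts G \<and>
      (lev u = lev v + 1 \<and> v = spine_parent lev a b u \<or> lev v = lev u + 1 \<and> u = spine_parent lev a b v
       \<or> \<delta> = 1 \<and> (u = a 0 \<and> v = b 0 \<or> u = b 0 \<and> v = a 0))"
      proof cases
        case 1
        then have "v = spine_parent lev a b u"
          using parent[OF V(1)] lower_neighbour_unique[OF vu] by auto
        then show ?thesis using 1 V by blast
      next
        case 2
        then have "u = spine_parent lev a b v"
          using parent[OF V(2)] lower_neighbour_unique[OF uv] by auto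
        then show ?thesis using 2 V by blast
      next
        case 3
        then show ?thesis using c0 V by auto
      qed
    next
      assume "u \<in> pverts G \<and> v \<in> pverts G \<and>
      (lev u = lev v + 1 \<and> v = spine_parent lev a b u \<or> lev v = lev u + 1 \<and> u = spine_parent lev a b v
       \<or> \<delta> = 1 \<and> (u = a 0 \<and> v = b 0 \<or> u = b 0 \<and> v = a 0))"
      then consider "u \<in> pverts G" "lev u = lev v + 1" "v = spine_parent lev a b u"
        | "v \<in> pverts G" "lev v = lev u + 1" "u = spine_parent lev a b v"
        | "\<delta> = 1" "u = a 0 \<and> v = b 0 \<or> u = b 0 \<and> v = a 0"
        by blast
      then show "(u, v) \<in> parcs G"
      proof cases
        case 1
        then have "1 \<le> lev u" by simp
        then show ?thesis using parent[OF 1(1)] 1(3) arcs_symmetric by simp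
      next
        case 2
        then have "1 \<le> lev v" by simp
        then show ?thesis using parent[OF 2(1)] 2(3) by simp
      next
        case 3
        then show ?thesis using c0 centre_arc arcs_symmetric by auto
      qed
    qed
    show "a i \<noteq> b i" if "1 \<le> i" "i \<le> h" for i using neq[of i] that by simp
    show "lev v \<le> h" if "v \<in> pverts G" for v using lev_le that .
    show "\<delta> \<le> 1" "1 \<le> h" by (rule parity_le, rule radius_pos)
  qed (use a b in simp_all)
  then show ?thesis using that by blast
qed

end

context weighted_centred_tree
begin

text \<open>
Tightness for all pairs of levels makes the thin side the same for all levels concerned: if one of
them has more than one far vertex, then each of them, compared with it, has a single near vertex.
\<close>

theorem extremal_double_spine:
  assumes tight: "level_bound f h \<delta> (\<lambda>i. card (level i)) \<le> dist_sum f G"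
  obtains a b where "double_spine G lev a b h \<delta>"
proof -
  have one: "(near_count i = 1 \<or> far_count j = 1) \<and> (far_count i = 1 \<or> near_count j = 1)"
    if "i \<le> j" "j \<le> h" "2 < 2 * i + \<delta>" for i j
    using tight_level_pair(1)[OF that tight_level_pairs[OF tight that(1,2)]] .
  have two: "d u v = 2"
    if uv: "i \<le> h" "2 < 2 * i + \<delta>" "u \<in> level i" "v \<in> level i" "far u = far v" "u \<noteq> v" for i u v
  proof -
    have "u \<in> pverts G" "v \<in> pverts G" using uv by (auto simp: level_def)
    then have "d u v \<noteq> 0" using dist_eq_0_iff uv(6) by blast
    then have "(u, v) \<in> skew_pairs i i"
      using uv by (auto simp: skew_pairs_def vertical_pairs_def cross_pairs_def)
    then show ?thesis
      using tight_level_pair(2)[OF order_refl uv(1,2) tight_level_pairs[OF tight order_refl uv(1)]] by simp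
  qed
  obtain \<beta> where \<beta>: "\<And>i. i \<le> h \<Longrightarrow> 2 < 2 * i + \<delta> \<Longrightarrow> (if \<beta> then far_count i else near_count i) = 1"
  proof (cases "\<forall>i\<le>h. 2 < 2 * i + \<delta> \<longrightarrow> far_count i = 1")
    case True
    then show ?thesis using that[of True] by simp
  next
    case False
    then obtain k where k: "k \<le> h" "2 < 2 * k + \<delta>" "far_count k \<noteq> 1" by blast
    have "near_count i = 1" if "i \<le> h" "2 < 2 * i + \<delta>" for i
      using one[of i k] one[of k i] k that by (cases "i \<le> k") auto
    then show ?thesis using that[of False] by simp
  qed
  have one_thin: "u = v" if uv: "i \<le> h" "2 < 2 * i + \<delta>" "u \<in> level i" "v \<in> level i" "far u = \<beta>" "far v = \<beta>" for i u v
  proof -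
    have "card {u \<in> level i. far u = \<beta>} = 1"
      using \<beta>[OF uv(1,2)] by (cases \<beta>) (simp_all add: near_count_def far_count_def)
    then obtain z where z: "{u \<in> level i. far u = \<beta>} = {z}" by (auto simp: card_1_singleton_iff)
    have "u \<in> {z}" "v \<in> {z}" using uv(3-6) unfolding z[symmetric] by simp_all
    then show ?thesis by simp
  qed
  show ?thesis
    by (rule double_spine_if_thin_side[of \<beta>]) (fact one_thin, fact two, fact that)
qed

end

section \<open>Indices and eccentric sequences\<close>

lemma (in connected_graph) pair_dist_doubleton:
  assumes "u \<in> pverts G" "v \<in> pverts G" "u \<noteq> v"
  shows "pair_dist G {u, v} = d u v"
  unfolding pair_dist_def
proof (rule the_equality)
  show "\<exists>u' v'. {u, v} = {u', v'} \<and> u' \<noteq> v' \<and> d u v = d u' v'" using assms by blast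
  show "k = d u v" if "\<exists>u' v'. {u, v} = {u', v'} \<and> u' \<noteq> v' \<and> k = d u' v'" for k
    using that dist_sym[OF assms(1,2)] by (auto simp: doubleton_eq_iff)
qed

lemma (in connected_graph) dist_sum_vertex_pairs:
  assumes "f 0 = 0"
  shows "dist_sum f G = 2 * (\<Sum>e\<in>vertex_pairs G. f (pair_dist G e))"
proof -
  let ?O = "{(u, v). u \<in> pverts G \<and> v \<in> pverts G \<and> u \<noteq> v}"
  let ?s = "\<lambda>(u, v). {u, v}"
  have fin: "finite (pverts G \<times> pverts G)" using pair_finite_verts by simp
  have finO: "finite ?O" by (rule finite_subset[OF _ fin]) auto
  have img: "?s ` ?O = vertex_pairs G" unfolding vertex_pairs_def by auto
  have "dist_sum f G = (\<Sum>(u, v)\<in>pverts G \<times> pverts G. f (d u v))"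
    unfolding dist_sum_def by (simp add: sum.cartesian_product)
  also have "\<dots> = (\<Sum>(u, v)\<in>?O. f (d u v))"
    using fin assms by (intro sum.mono_neutral_right) auto
  also have "\<dots> = (\<Sum>e\<in>vertex_pairs G. \<Sum>p\<in>{p \<in> ?O. ?s p = e}. case p of (u, v) \<Rightarrow> f (d u v))"
    using sum.image_gen[OF finO, of "\<lambda>(u, v). f (d u v)" ?s] unfolding img .
  also have "\<dots> = (\<Sum>e\<in>vertex_pairs G. 2 * f (pair_dist G e))"
  proof (rule sum.cong[OF refl])
    fix e assume "e \<in> vertex_pairs G"
    then obtain u v where e: "e = {u, v}" and uv: "u \<in> pverts G" "v \<in> pverts G" "u \<noteq> v"
      by (auto simp: vertex_pairs_def)
    have "{p \<in> ?O. ?s p = e} = {(u, v), (v, u)}"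
      using uv by (auto simp: e doubleton_eq_iff)
    moreover have "(\<Sum>p\<in>{(u, v), (v, u)}. case p of (u, v) \<Rightarrow> f (d u v)) = f (d u v) + f (d v u)"
      using uv(3) by simp
    ultimately show "(\<Sum>p\<in>{p \<in> ?O. ?s p = e}. case p of (u, v) \<Rightarrow> f (d u v)) = 2 * f (pair_dist G e)"
      using pair_dist_doubleton[OF uv] dist_sym[OF uv(1,2)] by (simp add: e)
  qed
  finally show ?thesis by (simp add: sum_distrib_left)
qed

lemma decreasing_weight_powr: "a < 0 \<Longrightarrow> decreasing_weight (\<lambda>k. real k powr a)"
  by unfold_locales (auto intro!: powr_less_mono2_neg)

lemma decreasing_weight_inverse: "decreasing_weight (\<lambda>k. 1 / real k)"
  by unfold_locales (auto intro!: divide_strict_left_mono)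

lemma (in connected_graph) wiener_dist_sum: "dist_sum (\<lambda>k. real k powr a) G = 2 * wiener a G"
  unfolding wiener_def by (rule dist_sum_vertex_pairs) simp

lemma (in connected_graph) harary_dist_sum: "dist_sum (\<lambda>k. 1 / real k) G = 2 * harary G"
  unfolding harary_def by (rule dist_sum_vertex_pairs) simp

lemma mset_eccentric_sequence:
  "mset (eccentric_sequence G) = image_mset (eccentricity G) (mset_set (pverts G))"
  by (simp add: eccentric_sequence_def)

lemma (in pair_fin_digraph) count_eccentric_sequence:
  "count_list (eccentric_sequence G) k = card {v \<in> pverts G. eccentricity G v = k}"
proof -
  have "count_list (eccentric_sequence G) k = count (mset (eccentric_sequence G)) k"
    by (simp add: count_mset)
  also have "\<dots> = (\<Sum>v\<in>eccentricity G -` {k} \<inter> pverts G. 1)"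
    unfolding mset_eccentric_sequence count_image_mset
    using pair_finite_verts by (intro sum.cong) auto
  also have "\<dots> = card {v \<in> pverts G. eccentricity G v = k}"
    by (simp add: vimage_def Int_def conj_commute)
  finally show ?thesis .
qed

lemma (in pair_fin_digraph) set_eccentric_sequence:
  "set (eccentric_sequence G) = eccentricity G ` pverts G"
  using arg_cong[OF mset_eccentric_sequence[of G], of set_mset] pair_finite_verts by simp

lemma (in pair_fin_digraph) length_eccentric_sequence:
  "length (eccentric_sequence G) = card (pverts G)"
  using arg_cong[OF mset_eccentric_sequence[of G], of size] by simp

lemma eccentric_sequence_eqI:
  assumes "pair_fin_digraph G" "pair_fin_digraph H"
    and "\<And>k. card {v \<in> pverts G. eccentricity G v = k} = card {v \<in> pverts H. eccentricity H v = k}"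
  shows "eccentric_sequence G = eccentric_sequence H"
proof -
  interpret G: pair_fin_digraph G by fact
  interpret H: pair_fin_digraph H by fact
  have "mset (eccentric_sequence G) = mset (eccentric_sequence H)"
    by (rule multiset_eqI)
      (simp only: count_mset G.count_eccentric_sequence H.count_eccentric_sequence assms(3))
  then show ?thesis
    unfolding mset_eccentric_sequence by (simp add: eccentric_sequence_def)
qed

context centred_tree
begin

lemma card_eccentricity:
  "card {v \<in> pverts G. eccentricity G v = k} = (if h + \<delta> \<le> k then card (level (k - h - \<delta>)) else 0)"
proof -
  have "{v \<in> pverts G. eccentricity G v = k} = {v \<in> pverts G. h + \<delta> \<le> k \<and> lev v = k - h - \<delta>}"
    using eccentricity_lev by force
  then show ?thesis by (auto simp: level_def)
qed

lemma level_nonempty: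
  assumes "i \<le> h"
  shows "\<exists>v. v \<in> level i"
proof -
  have "i \<le> lev x" using assms by simp
  then show ?thesis using ancestor_exists_any[OF ends(1)] unfolding level_def by blast
qed

text \<open>
Both sides reach up to level \<open>h\<close>.
\<close>

lemma level_ge_2:
  assumes "1 \<le> i" "i \<le> h"
  shows "2 \<le> card (level i)"
proof -
  obtain u v where uv: "u \<in> level i" "v \<in> level i" "far u" "\<not> far v"
    using side_nonempty[of i True] side_nonempty[of i False] assms by auto
  then have "card {u, v} = 2" by (cases "u = v") auto
  moreover have "card {u, v} \<le> card (level i)" using uv by (intro card_mono) auto
  ultimately show ?thesis by simp
qed

lemma card_level_0: "card (level 0) = 1 + \<delta>"
proof (cases "\<delta> = 1")
  case True
  have "level 0 = {c, q}" unfolding level_0 using True by (rule if_P)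
  moreover have "c \<noteq> q" using no_loops'[OF centre_arc] .
  ultimately show ?thesis using True by simp
next
  case False
  then have "level 0 = {c}" unfolding level_0 by (rule if_not_P)
  then show ?thesis using False parity_le by simp
qed

lemma short_form_eccentric_sequence:
  "short_form (eccentric_sequence G) = (h + \<delta>, map (\<lambda>i. card (level i)) [1..<Suc h])"
proof -
  have "set (eccentric_sequence G) = {h + \<delta>..<h + \<delta> + Suc h}"
  proof
    show "set (eccentric_sequence G) \<subseteq> {h + \<delta>..<h + \<delta> + Suc h}"
      unfolding set_eccentric_sequence using eccentricity_lev lev_le by force
    show "{h + \<delta>..<h + \<delta> + Suc h} \<subseteq> set (eccentric_sequence G)"
    proof
      fix k assume k: "k \<in> {h + \<delta>..<h + \<delta> + Suc h}"
      then have "k - h - \<delta> \<le> h" by auto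
      then obtain v where v: "v \<in> level (k - h - \<delta>)" using level_nonempty by blast
      then have "v \<in> pverts G" "lev v = k - h - \<delta>" by (simp_all add: level_def)
      then have "v \<in> pverts G" "k = eccentricity G v" using eccentricity_lev[of v] k by simp_all
      then show "k \<in> set (eccentric_sequence G)" unfolding set_eccentric_sequence by blast
    qed
  qed
  then have bs: "sorted_list_of_set (set (eccentric_sequence G)) = (h + \<delta>) # [Suc (h + \<delta>)..<h + \<delta> + Suc h]"
    by (simp add: upt_conv_Cons)
  have "map (count_list (eccentric_sequence G)) [Suc (h + \<delta>)..<h + \<delta> + Suc h]
      = map (\<lambda>i. card (level i)) [1..<Suc h]"
  proof (rule nth_equalityI)
    fix i assume "i < length (map (count_list (eccentric_sequence G)) [Suc (h + \<delta>)..<h + \<delta> + Suc h])"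
    then have i: "i < h" by (simp del: upt_Suc)
    then show "map (count_list (eccentric_sequence G)) [Suc (h + \<delta>)..<h + \<delta> + Suc h] ! i
        = map (\<lambda>i. card (level i)) [1..<Suc h] ! i"
      by (simp add: count_eccentric_sequence card_eccentricity del: upt_Suc)
  qed (simp del: upt_Suc)
  then show ?thesis unfolding short_form_def bs Let_def by simp
qed

end

lemma level_bound_cong:
  assumes "\<And>i. i \<le> h \<Longrightarrow> n i = n' i"
  shows "level_bound f h \<delta> n = level_bound f h \<delta> n'"
  unfolding level_bound_def level_pair_bound_def using assms
  by (intro sum.cong refl) (simp add: min_def max_def)

section \<open>The caterpillar as a double spine\<close>

text \<open>
The next two lemmas compare adjacency along the path \<open>v\<^sub>0, v\<^sub>1, \<dots>\<close> with adjacency in a double spine. Here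
\<open>H\<close> is the level of a path vertex and \<open>Q\<close> the index of its parent, \<open>h\<close> and \<open>h + e\<close> being the indices of
the centre.
\<close>

lemma path_step_arith:
  fixes p p' h e :: nat
  assumes "p < p'" "p' \<le> 2 * h + e" "e \<le> 1"
  defines "H \<equiv> \<lambda>p. if p \<le> h then h - p else p - h - e"
    and "Q \<equiv> \<lambda>p. if h + e \<le> p then h + e + (p - h - e - 1) else h - (h - p - 1)"
  shows "p' = p + 1 \<longleftrightarrow>
    H p = H p' + 1 \<and> p' = Q p \<or> H p' = H p + 1 \<and> p = Q p' \<or> e = 1 \<and> p = h \<and> p' = h + e"
proof -
  consider "p' \<le> h" | "p < h" "h < p'" | "p = h" "h < p'" "e = 0" | "p = h" "h < p'" "e = 1" | "h < p"
    using assms(1,3) by linarith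
  then show ?thesis
    by cases (use assms(1-3) in \<open>auto simp: H_def Q_def split: if_splits\<close>)
qed

lemma path_arc_arith:
  fixes p p' h e :: nat
  assumes b: "p \<le> 2 * h + e" "p' \<le> 2 * h + e" "e \<le> 1"
  defines "H \<equiv> \<lambda>p. if p \<le> h then h - p else p - h - e"
    and "Q \<equiv> \<lambda>p. if h + e \<le> p then h + e + (p - h - e - 1) else h - (h - p - 1)"
  shows "(p' = p + 1 \<and> p < 2 * h + e \<or> p = p' + 1 \<and> p' < 2 * h + e) \<longleftrightarrow>
    H p = H p' + 1 \<and> p' = Q p \<or> H p' = H p + 1 \<and> p = Q p'
      \<or> e = 1 \<and> (p = h \<and> p' = h + e \<or> p = h + e \<and> p' = h)"
proof (cases p p' rule: linorder_cases)
  case less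
  have "p < 2 * h + e" "p \<noteq> p' + 1" "\<not> (p = h + e \<and> p' = h)" using less b(2) by linarith+
  then show ?thesis using path_step_arith[OF less b(2,3)] unfolding H_def Q_def by blast
next
  case equal
  then have "p' \<noteq> p + 1" "p \<noteq> p' + 1" "H p \<noteq> H p' + 1" "H p' \<noteq> H p + 1" "\<not> (e = 1 \<and> p = h + e \<and> p' = h)"
    "\<not> (e = 1 \<and> p = h \<and> p' = h + e)"
    by auto
  then show ?thesis by blast
next
  case greater
  have "p' < 2 * h + e" "p' \<noteq> p + 1" "\<not> (p' = h + e \<and> p = h)" using greater b(1) by linarith+
  then show ?thesis using path_step_arith[OF greater b(1,3)] unfolding H_def Q_def by blast
qed
locale caterpillar_parameters =
  fixes h \<delta> :: nat and ms :: "nat list"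
  assumes h_pos: "1 \<le> h" and \<delta>_le: "\<delta> \<le> 1" and len: "length ms = h"
    and ms_ge: "\<And>i. i < h \<Longrightarrow> 2 \<le> ms ! i"
begin

abbreviation "C \<equiv> ecc_caterpillar (h + \<delta>) ms"

definition pendent :: "nat \<Rightarrow> nat \<Rightarrow> bool" where
  "pendent p k \<longleftrightarrow> 1 \<le> k \<and> 1 \<le> p \<and> p \<le> h \<and> k \<le> ms ! (h - p) - 2"

text \<open>
Pendent vertices are attached to \<open>v\<^sub>p\<close> with \<open>p = l + 1 - j\<close>, that is \<open>j - 2 = h - p\<close>.
\<close>

lemma pendent_iff:
  "(\<exists>j. p = length ms + 1 + 1 - j \<and> 2 \<le> j \<and> j \<le> length ms + 1 \<and> 1 \<le> k \<and> k \<le> ms ! (j - 2) - 2)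
    \<longleftrightarrow> pendent p k"
proof
  assume "pendent p k"
  then show "\<exists>j. p = length ms + 1 + 1 - j \<and> 2 \<le> j \<and> j \<le> length ms + 1 \<and> 1 \<le> k
      \<and> k \<le> ms ! (j - 2) - 2"
    by (intro exI[of _ "h + 2 - p"]) (auto simp: pendent_def len)
next
  assume "\<exists>j. p = length ms + 1 + 1 - j \<and> 2 \<le> j \<and> j \<le> length ms + 1 \<and> 1 \<le> k
      \<and> k \<le> ms ! (j - 2) - 2"
  then obtain j where j: "p = h + 2 - j" "2 \<le> j" "j \<le> h + 1" "1 \<le> k" "k \<le> ms ! (j - 2) - 2"
    by (auto simp: len)
  then have "h - p = j - 2" by linarith
  then show "pendent p k" using j by (auto simp: pendent_def)
qed

lemma caterpillar_verts: "(p, k) \<in> pverts C \<longleftrightarrow> k = 0 \<and> p \<le> 2 * h + \<delta> \<or> pendent p k"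
  unfolding pendent_iff[of p k, symmetric] by (auto simp: ecc_caterpillar_def Let_def len)

lemma caterpillar_arcs:
  "((p, k), (p', k')) \<in> parcs C \<longleftrightarrow>
    k = 0 \<and> k' = 0 \<and> (p' = p + 1 \<and> p < 2 * h + \<delta> \<or> p = p' + 1 \<and> p' < 2 * h + \<delta>)
    \<or> p = p' \<and> (k = 0 \<and> pendent p k' \<or> k' = 0 \<and> pendent p k)"
  unfolding pendent_iff[of p k, symmetric] pendent_iff[of p k', symmetric]
  by (auto simp: ecc_caterpillar_def Let_def len)

text \<open>
A pendent vertex is one level above the path vertex to which it is attached.
\<close>

definition height :: "nat \<times> nat \<Rightarrow> nat" where
  "height v = (if snd v = 0 then (if fst v \<le> h then h - fst v else fst v - h - \<delta>) else h + 1 - fst v)"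

definition left :: "nat \<Rightarrow> nat \<times> nat" where
  "left i = (h - i, 0)"

definition right :: "nat \<Rightarrow> nat \<times> nat" where
  "right i = (h + \<delta> + i, 0)"

lemma height_spine: "i \<le> h \<Longrightarrow> height (left i) = i" "i \<le> h \<Longrightarrow> height (right i) = i"
  by (auto simp: height_def left_def right_def)

lemma parent_caterpillar:
  assumes "(p, k) \<in> pverts C"
  shows "spine_parent height left right (p, k) =
    (if k \<noteq> 0 then (p, 0) else if h + \<delta> \<le> p then right (p - h - \<delta> - 1) else left (h - p - 1))"
  using assms \<delta>_le
  by (auto simp: caterpillar_verts pendent_def spine_parent_def height_def left_def right_def)

lemma caterpillar_double_spine: "double_spine C height left right h \<delta>"
proof
  have "pverts C \<subseteq> {..2 * h + \<delta>} \<times> {..Max (set ms) + 1}"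
  proof
    fix v assume v: "v \<in> pverts C"
    obtain p k where pk: "v = (p, k)" by (cases v)
    have "k \<le> Max (set ms)" if "pendent p k"
    proof -
      have "h - p < length ms" using that by (auto simp: pendent_def len)
      then have "ms ! (h - p) \<le> Max (set ms)" by (intro Max_ge) auto
      then show ?thesis using that by (auto simp: pendent_def)
    qed
    then show "v \<in> {..2 * h + \<delta>} \<times> {..Max (set ms) + 1}"
      using v by (auto simp: pk caterpillar_verts pendent_def)
  qed
  then show "finite (pverts C)" by (rule finite_subset) simp
  show "left i \<in> pverts C" "right i \<in> pverts C" if "i \<le> h" for i
    using that by (auto simp: left_def right_def caterpillar_verts)
  show "height (left i) = i" "height (right i) = i" if "i \<le> h" for i
    using that by (rule height_spine)+
  show "height v \<le> h" if "v \<in> pverts C" for v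
    using that by (cases v) (auto simp: caterpillar_verts height_def pendent_def)
  show "v = left 0 \<or> v = right 0" if "v \<in> pverts C" "height v = 0" for v
    using that \<delta>_le
    by (cases v) (auto simp: caterpillar_verts height_def pendent_def left_def right_def split: if_splits)
  show "left i \<noteq> right i" if "1 \<le> i" "i \<le> h" for i
    using that by (auto simp: left_def right_def)
  show "left 0 = right 0 \<longleftrightarrow> \<delta> = 0" "\<delta> \<le> 1" "1 \<le> h"
    using \<delta>_le h_pos by (auto simp: left_def right_def)
  show "(u, v) \<in> parcs C \<longleftrightarrow> u \<in> pverts C \<and> v \<in> pverts C \<and>
      (height u = height v + 1 \<and> v = spine_parent height left right u
       \<or> height v = height u + 1 \<and> u = spine_parent height left right v
       \<or> \<delta> = 1 \<and> (u = left 0 \<and> v = right 0 \<or> u = right 0 \<and> v = left 0))" for u v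
  proof -
    obtain p k where u: "u = (p, k)" by (cases u)
    obtain p' k' where v: "v = (p', k')" by (cases v)
    have d: "\<delta> = 0 \<or> \<delta> = 1" using \<delta>_le by auto
    have key: "((p, k), (p', k')) \<in> parcs C \<longleftrightarrow>
      (height (p, k) = height (p', k') + 1 \<and> (p', k') = spine_parent height left right (p, k)
       \<or> height (p', k') = height (p, k) + 1 \<and> (p, k) = spine_parent height left right (p', k')
       \<or> \<delta> = 1 \<and> ((p, k) = left 0 \<and> (p', k') = right 0 \<or> (p, k) = right 0 \<and> (p', k') = left 0))"
      if V: "(p, k) \<in> pverts C" "(p', k') \<in> pverts C"
    proof -
      note parents = parent_caterpillar[OF V(1)] parent_caterpillar[OF V(2)]
      consider (path) "k = 0" "k' = 0" | (up) "k = 0" "k' \<noteq> 0" | (down) "k \<noteq> 0" "k' = 0"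
        | (pendents) "k \<noteq> 0" "k' \<noteq> 0" by blast
      then show ?thesis
      proof cases
        case path
        then have b: "p \<le> 2 * h + \<delta>" "p' \<le> 2 * h + \<delta>"
          using V by (auto simp: caterpillar_verts pendent_def)
        have parents: "spine_parent height left right (p, 0)
            = (if h + \<delta> \<le> p then h + \<delta> + (p - h - \<delta> - 1) else h - (h - p - 1), 0)"
          "spine_parent height left right (p', 0)
            = (if h + \<delta> \<le> p' then h + \<delta> + (p' - h - \<delta> - 1) else h - (h - p' - 1), 0)"
          using parents path by (simp_all add: left_def right_def)
        show ?thesis
          using path_arc_arith[OF b \<delta>_le]
          unfolding path parents caterpillar_arcs pendent_def height_def left_def right_def
            fst_conv snd_conv
          by (simp split del: if_split)
      next
        case up
        then have "pendent p' k'" using V by (auto simp: caterpillar_verts)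
        then show ?thesis
          unfolding parents using up
          by (auto simp: caterpillar_arcs pendent_def height_def left_def right_def)
      next
        case down
        then have "pendent p k" using V by (auto simp: caterpillar_verts)
        then show ?thesis
          unfolding parents using down
          by (auto simp: caterpillar_arcs pendent_def height_def left_def right_def)
      next
        case pendents
        then show ?thesis
          unfolding parents by (simp add: caterpillar_arcs left_def right_def)
      qed
    qed
    have "(p, k) \<in> pverts C \<and> (p', k') \<in> pverts C" if "((p, k), (p', k')) \<in> parcs C"
      using that unfolding caterpillar_arcs caterpillar_verts by (auto simp: pendent_def)
    then show ?thesis using key unfolding u v by blast
  qed
qed

lemma caterpillar_level:
  assumes "1 \<le> i" "i \<le> h"
  shows "card {v \<in> pverts C. height v = i} = ms ! (i - 1)"
proof -
  have "{v \<in> pverts C. height v = i} = {left i, right i} \<union> Pair (h + 1 - i) ` {1..ms ! (i - 1) - 2}"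
    (is "?L = ?R")
  proof (rule set_eqI)
    fix v :: "nat \<times> nat"
    obtain p k where v: "v = (p, k)" by (cases v)
    have "pendent p k \<and> h + 1 - p = i \<longleftrightarrow> p = h + 1 - i \<and> 1 \<le> k \<and> k \<le> ms ! (i - 1) - 2"
    proof -
      have "h - p = i - 1" if "p = h + 1 - i" using that assms by linarith
      then show ?thesis using assms by (auto simp: pendent_def)
    qed
    moreover have "k \<noteq> 0" if "pendent p k" using that by (auto simp: pendent_def)
    ultimately show "v \<in> ?L \<longleftrightarrow> v \<in> ?R"
      using assms by (cases "k = 0") (auto simp: v caterpillar_verts height_def left_def right_def)
  qed
  moreover have "card \<dots> = card {left i, right i} + card (Pair (h + 1 - i) ` {1..ms ! (i - 1) - 2})"
    by (intro card_Un_disjoint) (auto simp: left_def right_def)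
  moreover have "card {left i, right i} = 2" using assms by (simp add: left_def right_def)
  moreover have "card (Pair (h + 1 - i) ` {1..ms ! (i - 1) - 2}) = ms ! (i - 1) - 2"
    by (subst card_image) (auto simp: inj_on_def)
  ultimately have "card {v \<in> pverts C. height v = i} = 2 + (ms ! (i - 1) - 2)"
    by (simp only:)
  moreover have "2 \<le> ms ! (i - 1)" using ms_ge[of "i - 1"] assms by simp
  ultimately show ?thesis by linarith
qed

lemma caterpillar_level_0: "card {v \<in> pverts C. height v = 0} = 1 + \<delta>"
proof -
  interpret double_spine C height left right h \<delta> by (rule caterpillar_double_spine)
  have "{v \<in> pverts C. height v = 0} = {left 0, right 0}"
    using L_0 spine_verts[of 0] L_spine[of 0] by auto
  then show ?thesis using centres by (cases "\<delta> = 0") auto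
qed

end

section \<open>Maximality of the caterpillar\<close>

text \<open>
The given sequence comes from some tree, and the sizes of its levels are the entries of \<open>ms\<close>. This
makes the parameters of the caterpillar meaningful, and it lets the bounds for an arbitrary tree with
the same sequence and for the caterpillar coincide.
\<close>

lemma ecc_caterpillar_maximal:
  fixes T :: "'v pair_pre_digraph"
  assumes S: "tree_eccentric_sequence S" "short_form S = (r, ms)"
  shows "is_tree (ecc_caterpillar r ms)" "eccentric_sequence (ecc_caterpillar r ms) = S"
    and "decreasing_weight f \<Longrightarrow> is_tree T \<Longrightarrow> eccentric_sequence T = S \<Longrightarrow>
      dist_sum f T \<le> dist_sum f (ecc_caterpillar r ms) \<and>
      (dist_sum f T = dist_sum f (ecc_caterpillar r ms) \<longleftrightarrow> graph_iso T (ecc_caterpillar r ms))"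
proof -
  obtain G :: "nat pair_pre_digraph" where G: "is_tree G" "2 < card (pverts G)" "eccentric_sequence G = S"
    using S(1) by (auto simp: tree_eccentric_sequence_def)
  interpret G: tree_graph G using G(1) by (simp add: is_tree_iff_tree_graph)
  obtain c q x y h \<delta> where "centred_tree G c q x y h \<delta>" using G.centred_tree_exists[OF G(2)] .
  then interpret G: centred_tree G c q x y h \<delta> .
  have rm: "r = h + \<delta>" "ms = map (\<lambda>i. card (G.level i)) [1..<Suc h]"
    using G.short_form_eccentric_sequence S(2) by (simp_all add: G(3) del: upt_Suc)
  have nth: "ms ! i = card (G.level (Suc i))" if "i < h" for i
    using that by (simp add: rm(2) del: upt_Suc)
  interpret caterpillar_parameters h \<delta> ms
  proof
    show "length ms = h" by (simp add: rm(2) del: upt_Suc)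
    show "2 \<le> ms ! i" if "i < h" for i using nth[OF that] G.level_ge_2[of "Suc i"] that by simp
  qed (rule G.radius_pos, rule G.parity_le)
  interpret C: double_spine C height left right h \<delta> by (rule caterpillar_double_spine)
  have C_level: "card (C.level i) = (if i = 0 then 1 + \<delta> else ms ! (i - 1))" if "i \<le> h" for i
    using caterpillar_level[of i] caterpillar_level_0 that by (simp add: C.level_def)
  show tree: "is_tree (ecc_caterpillar r ms)"
    unfolding rm(1) is_tree_iff_tree_graph by unfold_locales
  show "eccentric_sequence (ecc_caterpillar r ms) = S"
    unfolding rm(1) G(3)[symmetric]
  proof (rule eccentric_sequence_eqI)
    show "pair_fin_digraph C" "pair_fin_digraph G" by unfold_locales
    show "card {v \<in> pverts C. eccentricity C v = k} = card {v \<in> pverts G. eccentricity G v = k}" for k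
    proof -
      have "{v \<in> pverts C. eccentricity C v = k} = {v \<in> pverts C. h + \<delta> \<le> k \<and> height v = k - h - \<delta>}"
        using C.eccentricity_L by force
      then have "card {v \<in> pverts C. eccentricity C v = k}
          = (if h + \<delta> \<le> k then card (C.level (k - h - \<delta>)) else 0)"
        by (auto simp: C.level_def)
      moreover have "card (C.level i) = card (G.level i)" for i
      proof (cases "i \<le> h")
        case True
        then show ?thesis using C_level[OF True] nth[of "i - 1"] G.card_level_0 by simp
      next
        case False
        then have "C.level i = {}" "G.level i = {}"
          using C.L_le G.lev_le by (auto simp: C.level_def G.level_def)
        then show ?thesis by simp
      qed
      ultimately show ?thesis by (simp add: G.card_eccentricity)
    qed
  qed
  assume f: "decreasing_weight f" and T: "is_tree T" "eccentric_sequence T = S"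
  interpret T: tree_graph T using T(1) by (simp add: is_tree_iff_tree_graph)
  have "card (pverts T) = card (pverts G)"
    using T.length_eccentric_sequence G.length_eccentric_sequence T(2) G(3) by simp
  then obtain c' q' x' y' h' \<delta>' where ct: "centred_tree T c' q' x' y' h' \<delta>'"
    using T.centred_tree_exists G(2) by metis
  interpret T0: centred_tree T c' q' x' y' h' \<delta>' by (rule ct)
  have short: "h' + \<delta>' = h + \<delta>" "map (\<lambda>i. card (T0.level i)) [1..<Suc h'] = ms"
    using T0.short_form_eccentric_sequence S(2) by (simp_all add: T(2) rm(1) del: upt_Suc)
  then have h: "h' = h" using len by (auto simp del: upt_Suc)
  then have \<delta>: "\<delta>' = \<delta>" using short(1) by simp
  interpret T: weighted_centred_tree T c' q' x' y' h \<delta> f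
    using ct f by (simp add: weighted_centred_tree_def h \<delta>)
  interpret CW: weighted_double_spine C height left right h \<delta> f
    using caterpillar_double_spine f by (simp add: weighted_double_spine_def)
  have levels: "card (T.level i) = card (C.level i)" if "i \<le> h" for i
  proof (cases "i = 0")
    case True
    then show ?thesis using T.card_level_0 C_level[OF that] by simp
  next
    case False
    then have "ms ! (i - 1) = card (T.level i)"
      using short(2) that unfolding h \<delta> by (auto simp del: upt_Suc)
    then show ?thesis using C_level[OF that] False by simp
  qed
  have bound: "level_bound f h \<delta> (\<lambda>i. card (T.level i)) = level_bound f h \<delta> (\<lambda>i. card (C.level i))"
    by (rule level_bound_cong) (rule levels)
  have le: "dist_sum f T \<le> dist_sum f C"
    using T.dist_sum_le_level_bound CW.level_bound_le_dist_sum bound by linarith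
  have "graph_iso T C" if eq: "dist_sum f T = dist_sum f C"
  proof -
    have "level_bound f h \<delta> (\<lambda>i. card (T.level i)) \<le> dist_sum f T"
      using CW.level_bound_le_dist_sum bound eq by linarith
    then obtain a b where "double_spine T T.lev a b h \<delta>" by (rule T.extremal_double_spine)
    then show ?thesis
      using levels by (intro double_spine_iso[OF _ caterpillar_double_spine])
        (simp_all add: T.level_def C.level_def)
  qed
  moreover have "dist_sum f T = dist_sum f C" if "graph_iso T C"
    using that by (rule graph_iso_dist_sum) unfold_locales
  ultimately show "dist_sum f T \<le> dist_sum f (ecc_caterpillar r ms) \<and>
      (dist_sum f T = dist_sum f (ecc_caterpillar r ms) \<longleftrightarrow> graph_iso T (ecc_caterpillar r ms))"
    using le unfolding rm(1) by blast
qed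

theorem corollary2:
  fixes S :: "nat list" and r :: nat and ms :: "nat list"
  assumes "tree_eccentric_sequence S"
    and "short_form S = (r, ms)"
  shows "is_tree (ecc_caterpillar r ms)
    \<and> eccentric_sequence (ecc_caterpillar r ms) = S
    \<and> (\<forall>a::real. a < 0 \<longrightarrow>
        (\<forall>T :: 'v pair_pre_digraph. is_tree T \<and> eccentric_sequence T = S \<longrightarrow>
          wiener a T \<le> wiener a (ecc_caterpillar r ms) \<and>
          (wiener a T = wiener a (ecc_caterpillar r ms) \<longleftrightarrow> graph_iso T (ecc_caterpillar r ms))))
    \<and> (\<forall>T :: 'v pair_pre_digraph. is_tree T \<and> eccentric_sequence T = S \<longrightarrow>
          harary T \<le> harary (ecc_caterpillar r ms) \<and>
          (harary T = harary (ecc_caterpillar r ms) \<longleftrightarrow> graph_iso T (ecc_caterpillar r ms)))"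
proof (intro conjI allI impI)
  note maximal = ecc_caterpillar_maximal[OF assms]
  show tree: "is_tree (ecc_caterpillar r ms)" and "eccentric_sequence (ecc_caterpillar r ms) = S"
    by (rule maximal)+
  interpret C: connected_graph "ecc_caterpillar r ms" by (rule is_tree_connected_graph[OF tree])
  fix T :: "'v pair_pre_digraph" assume T: "is_tree T \<and> eccentric_sequence T = S"
  then interpret T: connected_graph T by (intro is_tree_connected_graph) simp
  have harary: "harary T \<le> harary (ecc_caterpillar r ms) \<and>
      (harary T = harary (ecc_caterpillar r ms) \<longleftrightarrow> graph_iso T (ecc_caterpillar r ms))"
    using maximal(3)[OF decreasing_weight_inverse, of T] T
    unfolding T.harary_dist_sum C.harary_dist_sum by simp
  then show "harary T \<le> harary (ecc_caterpillar r ms)"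
    "harary T = harary (ecc_caterpillar r ms) \<longleftrightarrow> graph_iso T (ecc_caterpillar r ms)" by blast+
  fix a :: real assume a: "a < 0"
  have "wiener a T \<le> wiener a (ecc_caterpillar r ms) \<and>
      (wiener a T = wiener a (ecc_caterpillar r ms) \<longleftrightarrow> graph_iso T (ecc_caterpillar r ms))"
    using maximal(3)[OF decreasing_weight_powr[OF a], of T] T
    unfolding T.wiener_dist_sum C.wiener_dist_sum by simp
  then show "wiener a T \<le> wiener a (ecc_caterpillar r ms)"
    "wiener a T = wiener a (ecc_caterpillar r ms) \<longleftrightarrow> graph_iso T (ecc_caterpillar r ms)" by blast+
qed

end
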